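(* Let $\Gamma$ be a discrete subgroup of $\mathrm{PSL}(2,\mathbb{R})$ acting freely on $\mathbb{H}^2$ with $\Gamma\backslash\mathbb{H}^2$ compact. Then the horocycle flow $(\theta^{\mathcal X}_t)_{t\in\mathbb{R}}$ on $\mathcal X=T^1(\Gamma\backslash\mathbb{H}^2)$ is KH-expansive.
   Context: Setting: $\mathbb{H}^2=\{z=x+iy\in\mathbb{C}: y>0\}$ is the hyperbolic plane with metric $ds^2=(dx^2+dy^2)/y^2$, on which $G=\mathrm{PSL}(2,\mathbb{R})=\mathrm{SL}(2,\mathbb{R})/\{\pm E_2\}$ acts by Möbius transformations. $X=\Gamma\backslash \mathrm{PSL}(2,\mathbb{R})=\{\Gamma g: g\in \mathrm{PSL}(2,\mathbb{R})\}$. $G$ carries a distance $d_G$ induced by a natural left-invariant Riemannian metric (normalized so that the class $a_t$ of $\mathrm{diag}(e^{t/2},e^{-t/2})$ satisfies $d_G(a_t,e)=|t|/\sqrt2$), and $X$ carries the distance $d_X(\Gamma g_1,\Gamma g_2)=\inf_{\gamma\in\Gamma}d_G(g_1,\gamma g_2)$. The unit tangent bundle $\mathcal X=T^1(\Gamma\backslash\mathbb{H}^2)$ is identified with $X$ by the standard bijection $\Xi:\mathcal X\to X$, whose inverse sends $\Gamma g$ to the image in $\mathcal X$ of the vertical unit vector at $i\in\mathbb{H}^2$ moved by $g$; the distance on $\mathcal X$ is the one making $\Xi$ an isometry. Horocycle flow: "the horocycle flow" means the stable one. Let $b_t\in\mathrm{PSL}(2,\mathbb{R})$ be the class of $\begin{pmatrix}1&t\\0&1\end{pmatrix}$.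 Put $\theta_t(\Gamma g)=\Gamma g b_t$ on $X$; the horocycle flow on $\mathcal X$ is $\theta^{\mathcal X}_t=\Xi^{-1}\circ\theta_t\circ\Xi$. KH-expansive (expansive in the sense of Katok-Hasselblatt): a continuous flow $\phi:\mathbb{R}\times M\to M$ on a compact metric space $(M,d)$ is KH-expansive if there exists $\delta>0$ such that, for all $x,y\in M$ and every continuous $s:\mathbb{R}\to\mathbb{R}$ with $s(0)=0$, if $d(\phi_t(x),\phi_{s(t)}(x))<\delta$ for all $t\in\mathbb{R}$ and $d(\phi_t(x),\phi_{s(t)}(y))<\delta$ for all $t\in\mathbb{R}$, then $x$ and $y$ lie on the same orbit of $\phi$. *)

theory Defs
  imports "HOL-Analysis.Analysis" "HOL-Algebra.Group_Action"
begin

section \<open>The group PSL(2,R)\<close>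

type_synonym mat2 = "real^2^2"

definition mat2 :: "real \<Rightarrow> real \<Rightarrow> real \<Rightarrow> real \<Rightarrow> mat2" where
  "mat2 a b c d = vector [vector [a, b], vector [c, d]]"

definition SL2 :: "mat2 monoid" where
  "SL2 = \<lparr>carrier = {A. det A = 1}, monoid.mult = (**), one = mat 1\<rparr>"

text \<open>The elements of \<open>PSL2\<close> are the two-element sets \<open>{A, - A}\<close>.\<close>

type_synonym psl2 = "mat2 set"

definition PSL2 :: "psl2 monoid" where
  "PSL2 = SL2 Mod {mat 1, - mat 1}"

definition psl :: "mat2 \<Rightarrow> psl2" where
  "psl A = {mat 1, - mat 1} #>\<^bsub>SL2\<^esub> A"

lemma mat2_nth [simp]:
  "mat2 a b c d $ 1 $ 1 = a" "mat2 a b c d $ 1 $ 2 = b"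
  "mat2 a b c d $ 2 $ 1 = c" "mat2 a b c d $ 2 $ 2 = d"
  by (simp_all add: mat2_def)

lemma group_SL2: "group SL2"
proof (rule groupI)
  fix A assume A: "A \<in> carrier SL2"
  then have "invertible A" by (simp add: SL2_def invertible_det_nz)
  then obtain B where B: "B ** A = mat 1" by (auto simp: invertible_def)
  then have "det B * det A = 1" by (metis det_mul det_I)
  with A B show "\<exists>B\<in>carrier SL2. B \<otimes>\<^bsub>SL2\<^esub> A = \<one>\<^bsub>SL2\<^esub>"
    by (auto simp: SL2_def)
qed (auto simp: SL2_def det_mul matrix_mul_assoc)

lemma uminus_eq_matrix_mult: "- A = - mat 1 ** (A :: mat2)" "- A = A ** - mat 1"
  by (simp_all add: vec_eq_iff matrix_matrix_mult_def mat_def sum_2 forall_2)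

lemma det_uminus_mat2 [simp]: "det (- A :: mat2) = det A"
  by (simp add: det_2)

lemma psl_eq: "psl A = {A, - A}"
  by (auto simp: psl_def r_coset_def SL2_def uminus_eq_matrix_mult(1)[of A])

lemma normal_pm1: "{mat 1, - mat 1} \<lhd> SL2"
proof -
  interpret group SL2 by (rule group_SL2)
  have "inv\<^bsub>SL2\<^esub> (- mat 1) = - mat 1"
    by (rule inv_equality) (simp_all add: SL2_def uminus_eq_matrix_mult(1)[symmetric])
  moreover have "inv\<^bsub>SL2\<^esub> (mat 1) = mat 1"
    by (rule inv_equality) (simp_all add: SL2_def)
  ultimately have "subgroup {mat 1, - mat 1} SL2"
    by unfold_locales (auto simp: SL2_def uminus_eq_matrix_mult(1)[symmetric])
  then show ?thesis
    unfolding normal_def normal_axioms_def using group_SL2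
    by (auto simp: r_coset_def l_coset_def SL2_def uminus_eq_matrix_mult[symmetric])
qed

lemma group_PSL2: "group PSL2"
  unfolding PSL2_def by (rule normal.factorgroup_is_group[OF normal_pm1])

lemma carrier_PSL2: "carrier PSL2 = psl ` {A. det A = 1}"
  by (auto simp: PSL2_def FactGroup_def RCOSETS_def psl_def SL2_def)

lemma psl_mult: "det A = 1 \<Longrightarrow> det B = 1 \<Longrightarrow> psl A \<otimes>\<^bsub>PSL2\<^esub> psl B = psl (A ** B)"
  using normal.rcos_sum[OF normal_pm1, of A B]
  by (simp add: PSL2_def FactGroup_def psl_def SL2_def)

lemma one_PSL2: "\<one>\<^bsub>PSL2\<^esub> = psl (mat 1)"
  by (simp add: psl_eq PSL2_def FactGroup_def)


section \<open>Quotient topologies and discreteness\<close>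

definition quotient_topology :: "'a topology \<Rightarrow> ('a \<Rightarrow> 'b) \<Rightarrow> 'b topology" where
  "quotient_topology T f =
     topology (\<lambda>U. U \<subseteq> f ` topspace T \<and> openin T {x \<in> topspace T. f x \<in> U})"

lemma openin_quotient_topology:
  "openin (quotient_topology T f) U \<longleftrightarrow>
     U \<subseteq> f ` topspace T \<and> openin T {x \<in> topspace T. f x \<in> U}"
proof -
  have "istopology (\<lambda>U. U \<subseteq> f ` topspace T \<and> openin T {x \<in> topspace T. f x \<in> U})"
    unfolding istopology_def
  proof (rule conjI; clarify)
    fix S U assume "openin T {x \<in> topspace T. f x \<in> S}" "openin T {x \<in> topspace T. f x \<in> U}"
      and S: "S \<subseteq> f ` topspace T"
    then have "openin T ({x \<in> topspace T. f x \<in> S} \<inter> {x \<in> topspace T. f x \<in> U})" by blast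
    moreover have "{x \<in> topspace T. f x \<in> S} \<inter> {x \<in> topspace T. f x \<in> U} =
                   {x \<in> topspace T. f x \<in> S \<inter> U}" by blast
    ultimately show "S \<inter> U \<subseteq> f ` topspace T \<and> openin T {x \<in> topspace T. f x \<in> S \<inter> U}"
      using S by auto
  next
    fix \<K> assume *: "\<forall>K\<in>\<K>. K \<subseteq> f ` topspace T \<and> openin T {x \<in> topspace T. f x \<in> K}"
    then have "openin T (\<Union>K\<in>\<K>. {x \<in> topspace T. f x \<in> K})" by blast
    moreover have "(\<Union>K\<in>\<K>. {x \<in> topspace T. f x \<in> K}) = {x \<in> topspace T. f x \<in> \<Union>\<K>}"
      by blast
    ultimately show "\<Union>\<K> \<subseteq> f ` topspace T \<and> openin T {x \<in> topspace T. f x \<in> \<Union>\<K>}"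
      using * by auto
  qed
  then show ?thesis by (simp add: quotient_topology_def)
qed

lemma topspace_quotient_topology: "topspace (quotient_topology T f) = f ` topspace T"
proof -
  have "{x \<in> topspace T. f x \<in> f ` topspace T} = topspace T" by blast
  then have "openin (quotient_topology T f) (f ` topspace T)"
    by (simp add: openin_quotient_topology)
  moreover have "topspace (quotient_topology T f) \<subseteq> f ` topspace T"
    using openin_topspace[of "quotient_topology T f"] by (simp only: openin_quotient_topology)
  ultimately show ?thesis using openin_subset by (metis subset_antisym)
qed

lemma quotient_map_quotient_topology: "quotient_map T (quotient_topology T f) f"
  by (auto simp: quotient_map_def topspace_quotient_topology openin_quotient_topology)

definition PSL2_topology :: "psl2 topology" where
  "PSL2_topology = quotient_topology (top_of_set (carrier SL2)) psl"

definition discrete_subgroup :: "psl2 set \<Rightarrow> bool" where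
  "discrete_subgroup \<Gamma> \<longleftrightarrow>
     subgroup \<Gamma> PSL2 \<and> subtopology PSL2_topology \<Gamma> = discrete_topology \<Gamma>"


section \<open>The action on the hyperbolic plane and on its unit tangent bundle\<close>

definition hyp_plane :: "complex set" where
  "hyp_plane = {z. Im z > 0}"

definition sl2_act :: "mat2 \<Rightarrow> complex \<Rightarrow> complex" where
  "sl2_act A = moebius (complex_of_real (A$1$1)) (complex_of_real (A$1$2))
                       (complex_of_real (A$2$1)) (complex_of_real (A$2$2))"

text \<open>Both representatives of \<open>g\<close> define the same Moebius transformation.\<close>

definition psl_act :: "psl2 \<Rightarrow> complex \<Rightarrow> complex" where
  "psl_act g = the_elem (sl2_act ` g)"

lemma psl_act_psl: "psl_act (psl A) = sl2_act A"
proof -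
  have "sl2_act (- A) = sl2_act A"
  proof
    fix z
    have "sl2_act (- A) z = (- (complex_of_real (A$1$1) * z + complex_of_real (A$1$2))) /
            (- (complex_of_real (A$2$1) * z + complex_of_real (A$2$2)))"
      by (simp add: sl2_act_def moebius_def)
    then show "sl2_act (- A) z = sl2_act A z"
      by (simp only: minus_divide_divide sl2_act_def moebius_def)
  qed
  then show ?thesis by (simp add: psl_act_def psl_eq)
qed

definition acts_freely :: "psl2 set \<Rightarrow> bool" where
  "acts_freely \<Gamma> \<longleftrightarrow> (\<forall>\<gamma>\<in>\<Gamma>. \<forall>z\<in>hyp_plane. psl_act \<gamma> z = z \<longrightarrow> \<gamma> = \<one>\<^bsub>PSL2\<^esub>)"

text \<open>The space of \<open>\<Gamma>\<close>-orbits in \<open>H\<^sup>2\<close>.\<close>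

definition orbit_surface :: "psl2 set \<Rightarrow> complex set topology" where
  "orbit_surface \<Gamma> =
     quotient_topology (top_of_set hyp_plane) (orbit (PSL2\<lparr>carrier := \<Gamma>\<rparr>) psl_act)"

text \<open>The differential of \<open>g\<close> at \<open>z\<close> is multiplication by the complex derivative.\<close>

definition tangent_act :: "psl2 \<Rightarrow> complex \<times> complex \<Rightarrow> complex \<times> complex" where
  "tangent_act g = (\<lambda>(z, v). (psl_act g z, deriv (psl_act g) z * v))"

text \<open>The hyperbolic norm of a tangent vector \<open>v\<close> at \<open>z\<close> is \<open>cmod v / Im z\<close>.\<close>

definition T1_hyp_plane :: "(complex \<times> complex) set" where
  "T1_hyp_plane = {(z, v). z \<in> hyp_plane \<and> cmod v / Im z = 1}"

text \<open>Since \<open>\<Gamma>\<close> acts freely and properly discontinuously by isometries, the differential of the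
  covering map from \<open>H\<^sup>2\<close> onto the orbit surface identifies the unit tangent bundle of the latter
  with the set of \<open>\<Gamma>\<close>-orbits of unit tangent vectors of \<open>H\<^sup>2\<close>.\<close>

definition T1_surface :: "psl2 set \<Rightarrow> (complex \<times> complex) set set" where
  "T1_surface \<Gamma> = orbits (PSL2\<lparr>carrier := \<Gamma>\<rparr>) T1_hyp_plane tangent_act"

text \<open>For \<open>C = \<Gamma> g\<close> this is the \<open>\<Gamma>\<close>-orbit of the vertical unit vector at \<open>\<i>\<close> moved by \<open>g\<close>;
  see \<open>Xi_inv_rcoset\<close> and \<open>bij_betw_Xi_inv\<close> below.\<close>

definition Xi_inv :: "psl2 set \<Rightarrow> (complex \<times> complex) set" where
  "Xi_inv C = (\<lambda>g. tangent_act g (\<i>, \<i>)) ` C"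

definition Xi :: "psl2 set \<Rightarrow> (complex \<times> complex) set \<Rightarrow> psl2 set" where
  "Xi \<Gamma> = inv_into (rcosets\<^bsub>PSL2\<^esub> \<Gamma>) Xi_inv"

lemma det_mat2: "det A = A$1$1 * A$2$2 - A$1$2 * A$2$1" for A :: mat2
  by (simp add: det_2)

lemma denom_nz:
  fixes A :: mat2
  assumes "det A = 1" "z \<in> hyp_plane"
  shows "complex_of_real (A$2$1) * z + complex_of_real (A$2$2) \<noteq> 0"
proof
  assume 0: "complex_of_real (A$2$1) * z + complex_of_real (A$2$2) = 0"
  then have "A$2$1 * Im z = 0" "A$2$1 * Re z + A$2$2 = 0"
    by (simp_all add: complex_eq_iff)
  with assms show False by (auto simp: hyp_plane_def det_2)
qed

lemma deriv_sl2_act: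
  assumes "det A = 1" "z \<in> hyp_plane"
  shows "(sl2_act A has_field_derivative
           1 / (complex_of_real (A$2$1) * z + complex_of_real (A$2$2))\<^sup>2) (at z)"
proof -
  let ?a = "complex_of_real (A$1$1)" and ?b = "complex_of_real (A$1$2)"
    and ?c = "complex_of_real (A$2$1)" and ?d = "complex_of_real (A$2$2)"
  have "complex_of_real (A$1$1 * A$2$2 - A$1$2 * A$2$1) = 1"
    using assms(1) by (simp only: det_2 of_real_1)
  then have "?a * ?d - ?b * ?c = 1" by simp
  moreover have "?a * (?c * z + ?d) - (?a * z + ?b) * ?c = ?a * ?d - ?b * ?c"
    by (simp add: algebra_simps)
  ultimately have num: "?a * (?c * z + ?d) - (?a * z + ?b) * ?c = 1" by simp
  have "((\<lambda>z. (?a * z + ?b) / (?c * z + ?d)) has_field_derivative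
          (?a * (?c * z + ?d) - (?a * z + ?b) * ?c) / ((?c * z + ?d) * (?c * z + ?d))) (at z)"
    by (rule DERIV_divide) (auto intro!: derivative_eq_intros denom_nz[OF assms])
  then show ?thesis
    unfolding num by (simp add: sl2_act_def moebius_def power2_eq_square)
qed

lemma tangent_act_psl:
  assumes "det A = 1" "z \<in> hyp_plane"
  shows "tangent_act (psl A) (z, v) =
    (sl2_act A z, v / (complex_of_real (A$2$1) * z + complex_of_real (A$2$2))\<^sup>2)"
  using DERIV_imp_deriv[OF deriv_sl2_act[OF assms]]
  by (simp add: tangent_act_def psl_act_psl)

lemma Im_sl2_act:
  assumes "det A = 1" "z \<in> hyp_plane"
  shows "Im (sl2_act A z) =
    Im z / (cmod (complex_of_real (A$2$1) * z + complex_of_real (A$2$2)))\<^sup>2"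
proof -
  have "Im z * (A$1$1 * A$2$2) = Im z * (1 + A$1$2 * A$2$1)"
    using assms(1) by (simp add: det_2)
  then show ?thesis
    unfolding sl2_act_def moebius_def Im_divide cmod_power2[symmetric] 
    by (simp add: algebra_simps)
qed

lemma T1_act_closed:
  assumes "det A = 1" "p \<in> T1_hyp_plane"
  shows "tangent_act (psl A) p \<in> T1_hyp_plane"
proof -
  obtain z v where p: "p = (z, v)" "z \<in> hyp_plane" "cmod v / Im z = 1" 
    using assms by (auto simp: T1_hyp_plane_def)
  show ?thesis using p(3) denom_nz[OF assms(1) p(2)] p(2)
    by (simp add: p(1) tangent_act_psl assms(1) p(2) T1_hyp_plane_def hyp_plane_def
        Im_sl2_act norm_divide norm_power field_simps)
qed

lemma tangent_act_mult:
  assumes "det A = 1" "det B = 1" "p \<in> T1_hyp_plane"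
  shows "tangent_act (psl A \<otimes>\<^bsub>PSL2\<^esub> psl B) p = tangent_act (psl A) (tangent_act (psl B) p)"
proof -
  obtain z v where p: "p = (z, v)" "z \<in> hyp_plane"
    using assms by (auto simp: T1_hyp_plane_def)
  have AB: "det (A ** B) = 1" by (simp add: det_mul assms)
  have w: "sl2_act B z \<in> hyp_plane"
    using p(2) denom_nz[OF assms(2) p(2)] by (simp add: hyp_plane_def Im_sl2_act assms)
  let ?d = "complex_of_real (B$2$1) * z + complex_of_real (B$2$2)"
  have d: "?d \<noteq> 0" by (rule denom_nz[OF assms(2) p(2)])
  have num: "complex_of_real (A$i$1) * sl2_act B z + complex_of_real (A$i$2) =
      (complex_of_real ((A**B)$i$1) * z + complex_of_real ((A**B)$i$2)) / ?d" for i
    using d by (simp add: sl2_act_def moebius_def matrix_matrix_mult_def sum_2 field_simps)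
  show ?thesis
    unfolding psl_mult[OF assms(1,2)] p(1) tangent_act_psl[OF AB p(2)]
      tangent_act_psl[OF assms(2) p(2)] tangent_act_psl[OF assms(1) w] num
    using d by (simp add: sl2_act_def[of A] sl2_act_def[of "A**B"] moebius_def num power_divide)
qed

lemma base_in_T1: "(\<i>, \<i>) \<in> T1_hyp_plane"
  by (simp add: T1_hyp_plane_def hyp_plane_def)

lemma tangent_act_transitive:
  assumes "p \<in> T1_hyp_plane"
  obtains A where "det A = 1" "tangent_act (psl A) (\<i>, \<i>) = p"
proof -
  obtain z v where p: "p = (z, v)" "Im z > 0" "cmod v = Im z"
    using assms by (auto simp: T1_hyp_plane_def hyp_plane_def)
  define w where "w = csqrt (\<i> / v)"
  have v0: "v \<noteq> 0" using p by auto
  have w2: "w\<^sup>2 = \<i> / v" by (simp add: w_def)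
  then have "cmod w ^ 2 = 1 / Im z" by (metis norm_power norm_divide norm_ii p(3))
  then have w: "(Re w)\<^sup>2 + (Im w)\<^sup>2 = 1 / Im z" by (simp add: cmod_power2)
  then have w0: "w \<noteq> 0" using p by auto
  define A where "A = mat2 (Im (z * w)) (Re (z * w)) (Im w) (Re w)"
  have "det A = Im z * ((Re w)\<^sup>2 + (Im w)\<^sup>2)"
    by (simp add: A_def det_2 power2_eq_square algebra_simps)
  then have det: "det A = 1" using w p by simp
  have 1: "complex_of_real (Im u) * \<i> + complex_of_real (Re u) = u" for u
    by (simp add: complex_eq_iff)
  have "tangent_act (psl A) (\<i>, \<i>) = p"
    using w0 v0
    by (subst tangent_act_psl[OF det])
       (simp_all add: hyp_plane_def p(1) sl2_act_def moebius_def A_def 1 w2 del: times_complex.sel)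
  with det show ?thesis by (rule that)
qed

lemma tangent_act_inj:
  assumes "det A = 1" "det B = 1" "tangent_act (psl A) (\<i>, \<i>) = tangent_act (psl B) (\<i>, \<i>)"
  shows "psl A = psl B"
proof -
  have i: "\<i> \<in> hyp_plane" by (simp add: hyp_plane_def)
  define n where "n M k = complex_of_real (M$k$1) * \<i> + complex_of_real (M$k$2)" for M :: mat2 and k
  have n_eqD: "A' = B'" if "n A' 1 = n B' 1" "n A' 2 = n B' 2" for A' B'
    using that by (simp add: n_def vec_eq_iff forall_2 complex_eq_iff)
  have n_minus: "n (- B) k = - n B k" for k by (simp add: n_def)
  have nz: "n A 2 \<noteq> 0" "n B 2 \<noteq> 0" using denom_nz[OF _ i] assms(1,2) by (auto simp: n_def)
  have "tangent_act (psl M) (\<i>, \<i>) = (n M 1 / n M 2, \<i> / (n M 2)\<^sup>2)" if "det M = 1" for M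
    using tangent_act_psl[OF that i, of \<i>] by (simp add: n_def sl2_act_def moebius_def)
  with assms have eq: "n A 1 / n A 2 = n B 1 / n B 2" "\<i> / (n A 2)\<^sup>2 = \<i> / (n B 2)\<^sup>2"
    by simp_all
  from eq(2) nz have "(n A 2)\<^sup>2 = (n B 2)\<^sup>2" by (simp add: divide_simps)
  then consider "n A 2 = n B 2" | "n A 2 = - n B 2" unfolding power2_eq_iff by blast
  then show ?thesis
  proof cases
    case 1
    with eq(1) nz have "n A 1 = n B 1" by simp
    with 1 have "A = B" by (intro n_eqD)
    then show ?thesis by simp
  next
    case 2
    with eq(1) nz have "- n A 1 = n B 1" by (simp add: divide_simps split: if_splits)
    then have "n A 1 = - n B 1" by (metis minus_minus)
    with 2 have "A = - B" by (intro n_eqD) (simp_all only: n_minus)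
    then show ?thesis by (auto simp: psl_eq)
  qed
qed

lemma Xi_inv_rcoset:
  assumes "subgroup \<Gamma> PSL2" "g \<in> carrier PSL2"
  shows "Xi_inv (\<Gamma> #>\<^bsub>PSL2\<^esub> g) = orbit (PSL2\<lparr>carrier := \<Gamma>\<rparr>) tangent_act (tangent_act g (\<i>, \<i>))"
proof -
  have "tangent_act (\<gamma> \<otimes>\<^bsub>PSL2\<^esub> g) (\<i>, \<i>) = tangent_act \<gamma> (tangent_act g (\<i>, \<i>))" if "\<gamma> \<in> \<Gamma>" for \<gamma>
    using subgroup.mem_carrier[OF assms(1) that] assms(2) base_in_T1
    by (auto simp: carrier_PSL2 tangent_act_mult)
  then have "(\<lambda>\<gamma>. tangent_act (\<gamma> \<otimes>\<^bsub>PSL2\<^esub> g) (\<i>, \<i>)) ` \<Gamma> = (\<lambda>\<gamma>. tangent_act \<gamma> (tangent_act g (\<i>, \<i>))) ` \<Gamma>"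
    by (rule image_cong[OF refl])
  then show ?thesis
    unfolding Xi_inv_def orbit_def r_coset_def by (auto simp: image_UN Setcompr_eq_image image_iff)
qed

lemma bij_betw_Xi_inv:
  assumes "subgroup \<Gamma> PSL2"
  shows "bij_betw Xi_inv (rcosets\<^bsub>PSL2\<^esub> \<Gamma>) (T1_surface \<Gamma>)"
proof -
  interpret group PSL2 by (rule group_PSL2)
  have inj: "inj_on (\<lambda>g. tangent_act g (\<i>, \<i>)) (carrier PSL2)"
  proof (rule inj_onI)
    fix g h assume "g \<in> carrier PSL2" "h \<in> carrier PSL2"
      and "tangent_act g (\<i>, \<i>) = tangent_act h (\<i>, \<i>)"
    then show "g = h" using tangent_act_inj unfolding carrier_PSL2 by blast
  qed
  have "inj_on Xi_inv (rcosets\<^bsub>PSL2\<^esub> \<Gamma>)"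
  proof (rule inj_onI)
    fix C D assume CD: "C \<in> rcosets\<^bsub>PSL2\<^esub> \<Gamma>" "D \<in> rcosets\<^bsub>PSL2\<^esub> \<Gamma>" "Xi_inv C = Xi_inv D"
    then have "C \<subseteq> carrier PSL2" "D \<subseteq> carrier PSL2"
      using subgroup.rcosets_carrier[OF assms group_PSL2] by auto
    with CD(3) inj show "C = D" by (simp add: Xi_inv_def inj_on_image_eq_iff)
  qed
  moreover have "Xi_inv ` (rcosets\<^bsub>PSL2\<^esub> \<Gamma>) = T1_surface \<Gamma>"
  proof -
    have T1: "T1_hyp_plane = (\<lambda>g. tangent_act g (\<i>, \<i>)) ` carrier PSL2"
    proof (intro subset_antisym subsetI)
      fix p assume "p \<in> T1_hyp_plane"
      then obtain A where "det A = 1" "tangent_act (psl A) (\<i>, \<i>) = p"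
        by (rule tangent_act_transitive)
      then show "p \<in> (\<lambda>g. tangent_act g (\<i>, \<i>)) ` carrier PSL2"
        unfolding carrier_PSL2 by blast
    next
      fix p assume "p \<in> (\<lambda>g. tangent_act g (\<i>, \<i>)) ` carrier PSL2"
      then show "p \<in> T1_hyp_plane"
        using T1_act_closed[OF _ base_in_T1] unfolding carrier_PSL2 by blast
    qed
    have "T1_surface \<Gamma> = (\<lambda>g. orbit (PSL2\<lparr>carrier := \<Gamma>\<rparr>) tangent_act (tangent_act g (\<i>, \<i>))) ` carrier PSL2"
      unfolding T1_surface_def orbits_def Setcompr_eq_image T1 image_image ..
    then show ?thesis
      by (auto simp: RCOSETS_def image_UN Xi_inv_rcoset[OF assms])
  qed
  ultimately show ?thesis by (simp add: bij_betw_def)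
qed


section \<open>The distances\<close>

text \<open>The left-invariant Riemannian metric on \<open>PSL2\<close> is the one given on the Lie algebra by
  \<open>\<langle>X, Y\<rangle> = trace (transpose X ** Y)\<close>, which is the inner product of \<^typ>\<open>real^2^2\<close>. A piecewise
  smooth curve in \<open>PSL2\<close> lifts to \<open>SL2\<close>, with either representative as initial point, and its
  length is the integral of the norm of the left logarithmic derivative of the lift.\<close>

definition has_length :: "(real \<Rightarrow> mat2) \<Rightarrow> real \<Rightarrow> bool" where
  "has_length c L \<longleftrightarrow>
     ((\<lambda>t. norm (matrix_inv (c t) ** vector_derivative c (at t))) has_integral L) {0..1}"

definition dist_G :: "psl2 \<Rightarrow> psl2 \<Rightarrow> real" where
  "dist_G g h = Inf {L. \<exists>c. valid_path c \<and> path_image c \<subseteq> carrier SL2 \<and>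
                            pathstart c \<in> g \<and> pathfinish c \<in> h \<and> has_length c L}"

text \<open>By left invariance this is \<open>inf {dist_G g\<^sub>1 (\<gamma> g\<^sub>2) | \<gamma> \<in> \<Gamma>}\<close> for \<open>C = \<Gamma> g\<^sub>1\<close> and
  \<open>D = \<Gamma> g\<^sub>2\<close>; see \<open>dist_X_rcoset\<close>.\<close>

definition dist_X :: "psl2 set \<Rightarrow> psl2 set \<Rightarrow> real" where
  "dist_X C D = (INF (g, h)\<in>C \<times> D. dist_G g h)"

lemma
  fixes A :: mat2
  assumes "det A = 1"
  shows matrix_inv_mat2: "matrix_inv A = mat2 (A$2$2) (- A$1$2) (- A$2$1) (A$1$1)"
    and matrix_inv_mat2_inverse: "A ** matrix_inv A = mat 1" "matrix_inv A ** A = mat 1"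
proof -
  let ?B = "mat2 (A$2$2) (- A$1$2) (- A$2$1) (A$1$1)"
  have AB: "A ** ?B = mat 1" "?B ** A = mat 1"
    using assms by (simp_all add: vec_eq_iff forall_2 matrix_matrix_mult_def sum_2 mat_def det_2 algebra_simps)
  then have "A ** matrix_inv A = mat 1 \<and> matrix_inv A ** A = mat 1"
    unfolding matrix_inv_def by (rule_tac someI_ex) blast
  then show 1: "A ** matrix_inv A = mat 1" and 2: "matrix_inv A ** A = mat 1" by simp_all
  have "matrix_inv A = matrix_inv A ** (A ** ?B)" unfolding AB(1) by simp
  also have "\<dots> = ?B" unfolding matrix_mul_assoc 2 by simp
  finally show "matrix_inv A = ?B" .
qed

lemma bounded_linear_matrix_mult: "bounded_linear (\<lambda>X :: mat2. A ** X)" for A :: mat2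
  unfolding linear_conv_bounded_linear[symmetric]
  by (rule linearI) (simp_all add: matrix_add_ldistrib matrix_matrix_mult_def vec_eq_iff sum_2 algebra_simps)

lemma has_length_mult:
  assumes "valid_path c" "path_image c \<subseteq> carrier SL2" "det A = 1" "has_length c L"
  shows "valid_path (\<lambda>t. A ** c t)" "has_length (\<lambda>t. A ** c t) L"
proof -
  obtain S D where S: "finite S" "continuous_on {0..1} c" "continuous_on ({0..1} - S) D"
    and D: "\<And>t. t \<in> {0..1} - S \<Longrightarrow> (c has_vector_derivative D t) (at t)"
    using assms(1) unfolding valid_path_def piecewise_C1_differentiable_on_def C1_differentiable_on_def
    by metis
  note bl = bounded_linear_matrix_mult[of A]
  have AD: "((\<lambda>t. A ** c t) has_vector_derivative A ** D t) (at t)" if "t \<in> {0..1} - S" for t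
    by (rule bounded_linear.has_vector_derivative[OF bl D[OF that]])
  have "(\<lambda>t. A ** c t) C1_differentiable_on {0..1} - S"
    unfolding C1_differentiable_on_def
    by (intro exI[of _ "\<lambda>t. A ** D t"] conjI ballI AD bounded_linear.continuous_on[OF bl S(3)])
  with S(1) bounded_linear.continuous_on[OF bl S(2)] show "valid_path (\<lambda>t. A ** c t)"
    unfolding valid_path_def piecewise_C1_differentiable_on_def by blast
  have inv: "matrix_inv (A ** X) ** (A ** Y) = matrix_inv X ** Y" if "det X = 1" for X Y :: mat2
  proof -
    have "det (A ** X) = 1" using assms(3) that by (simp only: det_mul mult_1)
    then have 1: "matrix_inv (A ** X) ** (A ** X) = mat 1" by (rule matrix_inv_mat2_inverse)
    have "A ** Y = A ** (X ** matrix_inv X) ** Y"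
      by (simp only: matrix_inv_mat2_inverse(1)[OF that] matrix_mul_rid)
    then have "matrix_inv (A ** X) ** (A ** Y) = (matrix_inv (A ** X) ** (A ** X)) ** (matrix_inv X ** Y)"
      by (simp only: matrix_mul_assoc)
    then show ?thesis by (simp only: 1 matrix_mul_lid)
  qed
  have "norm (matrix_inv (A ** c t) ** vector_derivative (\<lambda>t. A ** c t) (at t)) =
        norm (matrix_inv (c t) ** vector_derivative c (at t))" if "t \<in> {0..1} - S" for t
  proof -
    have "c t \<in> carrier SL2" using assms(2) that by (auto simp: path_image_def)
    then have "det (c t) = 1" by (simp add: SL2_def)
    then show ?thesis
      by (simp add: vector_derivative_at[OF D[OF that]] vector_derivative_at[OF AD[OF that]] inv)
  qed
  then show "has_length (\<lambda>t. A ** c t) L"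
    using assms(4) S(1) unfolding has_length_def
    by (rule_tac has_integral_spike_finite) auto
qed

lemma dist_G_left_invariant:
  assumes "k \<in> carrier PSL2" "g \<in> carrier PSL2" "h \<in> carrier PSL2"
  shows "dist_G (k \<otimes>\<^bsub>PSL2\<^esub> g) (k \<otimes>\<^bsub>PSL2\<^esub> h) = dist_G g h"
proof -
  interpret group PSL2 by (rule group_PSL2)
  define P where "P g h = {L. \<exists>c. valid_path c \<and> path_image c \<subseteq> carrier SL2 \<and>
                            pathstart c \<in> g \<and> pathfinish c \<in> h \<and> has_length c L}" for g h
  have mem: "A ** B \<in> psl A \<otimes>\<^bsub>PSL2\<^esub> g"
    if A: "det A = 1" and g: "g \<in> carrier PSL2" and B: "B \<in> g" for A B g
  proof -
    obtain C where C: "g = psl C" "det C = 1" using g by (auto simp: carrier_PSL2)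
    have "A ** - C = - (A ** C)"
      by (simp add: vec_eq_iff matrix_matrix_mult_def sum_negf)
    with B show ?thesis
      unfolding C(1) psl_mult[OF A C(2)] by (auto simp: psl_eq)
  qed
  have sub: "P g h \<subseteq> P (k \<otimes>\<^bsub>PSL2\<^esub> g) (k \<otimes>\<^bsub>PSL2\<^esub> h)"
    if gh: "k \<in> carrier PSL2" "g \<in> carrier PSL2" "h \<in> carrier PSL2" for k g h
  proof
    fix L assume "L \<in> P g h"
    then obtain c where c: "valid_path c" "path_image c \<subseteq> carrier SL2"
      "pathstart c \<in> g" "pathfinish c \<in> h" "has_length c L" by (auto simp: P_def)
    obtain A where A: "k = psl A" "det A = 1" using gh by (auto simp: carrier_PSL2)
    have "path_image (\<lambda>t. A ** c t) \<subseteq> carrier SL2"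
      using c(2) A(2) by (auto simp: path_image_def SL2_def det_mul)
    moreover have "pathstart (\<lambda>t. A ** c t) \<in> k \<otimes>\<^bsub>PSL2\<^esub> g" "pathfinish (\<lambda>t. A ** c t) \<in> k \<otimes>\<^bsub>PSL2\<^esub> h"
      using mem[OF A(2)] c(3,4) gh A(1) by (auto simp: pathstart_def pathfinish_def)
    ultimately show "L \<in> P (k \<otimes>\<^bsub>PSL2\<^esub> g) (k \<otimes>\<^bsub>PSL2\<^esub> h)"
      using has_length_mult[OF c(1,2) A(2) c(5)] unfolding P_def by blast
  qed
  have "P (k \<otimes>\<^bsub>PSL2\<^esub> g) (k \<otimes>\<^bsub>PSL2\<^esub> h) \<subseteq> P g h"
  proof -
    have "inv\<^bsub>PSL2\<^esub> k \<otimes>\<^bsub>PSL2\<^esub> (k \<otimes>\<^bsub>PSL2\<^esub> x) = x" if "x \<in> carrier PSL2" for x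
      using m_assoc[OF inv_closed[OF assms(1)] assms(1) that] l_inv[OF assms(1)] l_one[OF that] by simp
    then show ?thesis
      using sub[of "inv\<^bsub>PSL2\<^esub> k" "k \<otimes>\<^bsub>PSL2\<^esub> g" "k \<otimes>\<^bsub>PSL2\<^esub> h"] assms
      by (simp only: inv_closed m_closed)
  qed
  with sub[OF assms] have "P (k \<otimes>\<^bsub>PSL2\<^esub> g) (k \<otimes>\<^bsub>PSL2\<^esub> h) = P g h" by blast
  then show ?thesis by (simp add: dist_G_def P_def)
qed

lemma dist_X_rcoset:
  assumes "subgroup \<Gamma> PSL2" "g\<^sub>1 \<in> carrier PSL2" "g\<^sub>2 \<in> carrier PSL2"
  shows "dist_X (\<Gamma> #>\<^bsub>PSL2\<^esub> g\<^sub>1) (\<Gamma> #>\<^bsub>PSL2\<^esub> g\<^sub>2) = (INF \<gamma>\<in>\<Gamma>. dist_G g\<^sub>1 (\<gamma> \<otimes>\<^bsub>PSL2\<^esub> g\<^sub>2))"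
proof -
  interpret group PSL2 by (rule group_PSL2)
  interpret H: subgroup \<Gamma> PSL2 by (rule assms)
  have "dist_G (\<gamma> \<otimes>\<^bsub>PSL2\<^esub> g\<^sub>1) (\<gamma>' \<otimes>\<^bsub>PSL2\<^esub> g\<^sub>2) = dist_G g\<^sub>1 ((inv\<^bsub>PSL2\<^esub> \<gamma> \<otimes>\<^bsub>PSL2\<^esub> \<gamma>') \<otimes>\<^bsub>PSL2\<^esub> g\<^sub>2)"
    if "\<gamma> \<in> \<Gamma>" "\<gamma>' \<in> \<Gamma>" for \<gamma> \<gamma>'
    using dist_G_left_invariant[of \<gamma> g\<^sub>1 "(inv\<^bsub>PSL2\<^esub> \<gamma> \<otimes>\<^bsub>PSL2\<^esub> \<gamma>') \<otimes>\<^bsub>PSL2\<^esub> g\<^sub>2"] that assms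
    by (simp add: m_assoc[symmetric])
  then have "(\<lambda>(g, h). dist_G g h) ` ((\<Gamma> #>\<^bsub>PSL2\<^esub> g\<^sub>1) \<times> (\<Gamma> #>\<^bsub>PSL2\<^esub> g\<^sub>2)) \<subseteq>
      (\<lambda>\<gamma>. dist_G g\<^sub>1 (\<gamma> \<otimes>\<^bsub>PSL2\<^esub> g\<^sub>2)) ` \<Gamma>"
    by (auto simp: r_coset_def intro!: imageI)
  moreover have "(\<lambda>\<gamma>. dist_G g\<^sub>1 (\<gamma> \<otimes>\<^bsub>PSL2\<^esub> g\<^sub>2)) ` \<Gamma> \<subseteq>
      (\<lambda>(g, h). dist_G g h) ` ((\<Gamma> #>\<^bsub>PSL2\<^esub> g\<^sub>1) \<times> (\<Gamma> #>\<^bsub>PSL2\<^esub> g\<^sub>2))"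
  proof clarify
    fix \<gamma> assume "\<gamma> \<in> \<Gamma>"
    then have "(g\<^sub>1, \<gamma> \<otimes>\<^bsub>PSL2\<^esub> g\<^sub>2) \<in> (\<Gamma> #>\<^bsub>PSL2\<^esub> g\<^sub>1) \<times> (\<Gamma> #>\<^bsub>PSL2\<^esub> g\<^sub>2)"
      using assms rcos_self by (auto simp: r_coset_def)
    then show "dist_G g\<^sub>1 (\<gamma> \<otimes>\<^bsub>PSL2\<^esub> g\<^sub>2) \<in>
      (\<lambda>(g, h). dist_G g h) ` ((\<Gamma> #>\<^bsub>PSL2\<^esub> g\<^sub>1) \<times> (\<Gamma> #>\<^bsub>PSL2\<^esub> g\<^sub>2))"
      by (rule rev_image_eqI) simp
  qed
  ultimately show ?thesis unfolding dist_X_def by (metis subset_antisym)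
qed

lemma norm_mat2: "norm X = sqrt ((X$1$1)\<^sup>2 + (X$1$2)\<^sup>2 + (X$2$1)\<^sup>2 + (X$2$2)\<^sup>2)" for X :: mat2
  by (simp add: norm_eq_sqrt_inner inner_vec_def sum_2 power2_eq_square)

lemma length_ge_ln:
  assumes "valid_path c" "path_image c \<subseteq> carrier SL2" "has_length c L"
  defines "f \<equiv> \<lambda>t. ln ((c t $ 1 $ 1)\<^sup>2 + (c t $ 1 $ 2)\<^sup>2)"
  shows "\<bar>f 1 - f 0\<bar> \<le> sqrt 2 * L"
proof -
  obtain S D where S: "finite S" "continuous_on {0..1} c"
    and D: "\<And>t. t \<in> {0..1} - S \<Longrightarrow> (c has_vector_derivative D t) (at t)"
    using assms(1) unfolding valid_path_def piecewise_C1_differentiable_on_def C1_differentiable_on_def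
    by metis
  have det: "c t $ 1 $ 1 * c t $ 2 $ 2 - c t $ 1 $ 2 * c t $ 2 $ 1 = 1" if "t \<in> {0..1}" for t
  proof -
    have "c t \<in> carrier SL2" using assms(2) that by (auto simp: path_image_def)
    then show ?thesis by (simp add: SL2_def det_2)
  qed
  have pos: "(c t $ 1 $ 1)\<^sup>2 + (c t $ 1 $ 2)\<^sup>2 > 0" if "t \<in> {0..1}" for t
    using det[OF that] by (auto simp: sum_power2_gt_zero_iff)
  define f' where "f' t = (if t \<in> {0<..<1} - S then
    2 * (c t $ 1 $ 1 * D t $ 1 $ 1 + c t $ 1 $ 2 * D t $ 1 $ 2) / ((c t $ 1 $ 1)\<^sup>2 + (c t $ 1 $ 2)\<^sup>2) else 0)" for t
  define X where "X t = norm (matrix_inv (c t) ** vector_derivative c (at t))" for t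
  have comp: "((\<lambda>t. c t $ i $ j) has_real_derivative D t $ i $ j) (at t)" if "t \<in> {0..1} - S" for t i j
    using D[OF that] bounded_linear.has_vector_derivative[OF bounded_linear_vec_nth]
    unfolding has_real_derivative_iff_has_vector_derivative by metis
  have "(f has_vector_derivative f' t) (at t)" if "t \<in> {0<..<1} - S" for t
    unfolding has_real_derivative_iff_has_vector_derivative[symmetric] f_def f'_def using that pos[of t]
    by (auto intro!: derivative_eq_intros comp simp: divide_simps)
  moreover have "continuous_on {0..1} f"
    unfolding f_def using pos less_imp_neq[OF pos] by (intro continuous_intros S(2)) force
  ultimately have "(f' has_integral f 1 - f 0) {0..1}"
    by (intro fundamental_theorem_of_calculus_interior_strong[OF S(1)]) auto
  moreover have "((\<lambda>t. sqrt 2 * X t) has_integral sqrt 2 * L) {0..1}"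
    using assms(3) unfolding has_length_def X_def by (rule has_integral_mult_right)
  moreover have "norm (f' t) \<le> sqrt 2 * X t" if "t \<in> {0..1}" for t
  proof (cases "t \<in> {0<..<1} - S")
    case True
    then have t: "t \<in> {0..1} - S" by auto
    define a b c' d where abcd: "a = c t $ 1 $ 1" "b = c t $ 1 $ 2" "c' = c t $ 2 $ 1" "d = c t $ 2 $ 2"
    define x y z w where xyzw: "x = d * D t $ 1 $ 1 - b * D t $ 2 $ 1" "y = d * D t $ 1 $ 2 - b * D t $ 2 $ 2"
      "z = a * D t $ 2 $ 1 - c' * D t $ 1 $ 1" "w = a * D t $ 2 $ 2 - c' * D t $ 1 $ 2"
    have d1: "a * d - b * c' = 1" using det[of t] t by (simp add: abcd)
    have "((\<lambda>t. c t $ 1 $ 1 * c t $ 2 $ 2 - c t $ 1 $ 2 * c t $ 2 $ 1) has_real_derivative x + w) (at t)"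
      by (auto intro!: derivative_eq_intros comp t simp: abcd xyzw)
    moreover have "((\<lambda>t. c t $ 1 $ 1 * c t $ 2 $ 2 - c t $ 1 $ 2 * c t $ 2 $ 1) has_real_derivative 0) (at t)"
      by (rule has_field_derivative_transform_within_open[where f = "\<lambda>_. 1" and S = "{0<..<1}"])
         (use True det in auto)
    ultimately have w: "w = - x" using DERIV_unique by fastforce
    have "matrix_inv (c t) ** D t = mat2 x y z w"
      using det[of t] t by (simp add: matrix_inv_mat2 det_2 vec_eq_iff forall_2 matrix_matrix_mult_def sum_2 abcd xyzw)
    then have X: "X t = sqrt (x\<^sup>2 + y\<^sup>2 + z\<^sup>2 + w\<^sup>2)"
      by (simp add: X_def vector_derivative_at[OF D[OF t]] norm_mat2)
    have "D t $ 1 $ 1 = (a * d - b * c') * D t $ 1 $ 1" "D t $ 1 $ 2 = (a * d - b * c') * D t $ 1 $ 2"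
      by (simp_all add: d1)
    then have D12: "D t $ 1 $ 1 = a * x + b * z" "D t $ 1 $ 2 = a * y + b * w"
      by (simp_all add: xyzw algebra_simps)
    have "2 * \<bar>a * (a * x + b * z) + b * (a * y + b * w)\<bar> \<le> sqrt 2 * X t * (a\<^sup>2 + b\<^sup>2)"
    proof -
      have "(2 * (a * (a * x + b * z) + b * (a * y + b * w)))\<^sup>2 \<le> (sqrt 2 * X t * (a\<^sup>2 + b\<^sup>2))\<^sup>2"
      proof -
        have "(sqrt 2 * X t * (a\<^sup>2 + b\<^sup>2))\<^sup>2 = 2 * (x\<^sup>2 + y\<^sup>2 + z\<^sup>2 + w\<^sup>2) * (a\<^sup>2 + b\<^sup>2)\<^sup>2"
          by (simp add: X power_mult_distrib)
        moreover have "2 * (x\<^sup>2 + y\<^sup>2 + z\<^sup>2 + w\<^sup>2) * (a\<^sup>2 + b\<^sup>2)\<^sup>2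
            - (2 * (a * (a * x + b * z) + b * (a * y + b * w)))\<^sup>2
          = 2 * (y - z)\<^sup>2 * (a\<^sup>2 + b\<^sup>2)\<^sup>2 - (y - z)\<^sup>2 * (a\<^sup>2 + b\<^sup>2)\<^sup>2
            + (4 * a * b * x - (a\<^sup>2 - b\<^sup>2) * (y + z))\<^sup>2"
          unfolding w by (simp add: power2_eq_square algebra_simps)
        moreover have "0 \<le> (y - z)\<^sup>2 * (a\<^sup>2 + b\<^sup>2)\<^sup>2" by simp
        moreover have "0 \<le> (4 * a * b * x - (a\<^sup>2 - b\<^sup>2) * (y + z))\<^sup>2" by simp
        ultimately show ?thesis by linarith
      qed
      then have "\<bar>2 * (a * (a * x + b * z) + b * (a * y + b * w))\<bar> \<le> \<bar>sqrt 2 * X t * (a\<^sup>2 + b\<^sup>2)\<bar>"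
        by (simp only: abs_le_square_iff)
      moreover have "0 \<le> sqrt 2 * X t * (a\<^sup>2 + b\<^sup>2)" by (simp add: X_def)
      ultimately show ?thesis by linarith
    qed
    moreover have "f' t = 2 * (a * (a * x + b * z) + b * (a * y + b * w)) / (a\<^sup>2 + b\<^sup>2)"
      using True unfolding f'_def D12[symmetric] by (simp add: abcd)
    moreover have "a\<^sup>2 + b\<^sup>2 > 0" using pos[of t] t by (simp add: abcd)
    ultimately show ?thesis
      by (simp only: real_norm_def abs_divide abs_mult[of 2] divide_le_eq abs_of_pos) simp
  qed (auto simp: f'_def X_def)
  ultimately show ?thesis
    using integral_norm_bound_integral[of f' "{0..1}" "\<lambda>t. sqrt 2 * X t"]
    by (metis has_integral_integrable integral_unique real_norm_def)
qed

text \<open>The normalization of the metric.\<close>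

lemma dist_G_diagonal:
  "dist_G (psl (mat2 (exp (t / 2)) 0 0 (exp (- t / 2)))) \<one>\<^bsub>PSL2\<^esub> = \<bar>t\<bar> / sqrt 2"
proof -
  let ?g = "psl (mat2 (exp (t / 2)) 0 0 (exp (- t / 2)))"
  let ?P = "{L. \<exists>c. valid_path c \<and> path_image c \<subseteq> carrier SL2 \<and>
                  pathstart c \<in> ?g \<and> pathfinish c \<in> \<one>\<^bsub>PSL2\<^esub> \<and> has_length c L}"
  have "\<bar>t\<bar> / sqrt 2 \<le> L" if "L \<in> ?P" for L
  proof -
    from that obtain c where "valid_path c \<and> path_image c \<subseteq> carrier SL2 \<and>
        pathstart c \<in> ?g \<and> pathfinish c \<in> \<one>\<^bsub>PSL2\<^esub> \<and> has_length c L"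
      unfolding mem_Collect_eq by (rule exE)
    then have c: "valid_path c" "path_image c \<subseteq> carrier SL2"
      "c 0 \<in> ?g" "c 1 \<in> \<one>\<^bsub>PSL2\<^esub>" "has_length c L"
      unfolding pathstart_def pathfinish_def by simp_all
    have "ln ((c 1 $ 1 $ 1)\<^sup>2 + (c 1 $ 1 $ 2)\<^sup>2) = 0"
      using c(4) by (auto simp: one_PSL2 psl_eq mat_def)
    moreover have "ln ((c 0 $ 1 $ 1)\<^sup>2 + (c 0 $ 1 $ 2)\<^sup>2) = t"
    proof -
      have "(exp (t / 2))\<^sup>2 = exp t" by (simp add: power2_eq_square flip: exp_add)
      then show ?thesis using c(3) by (auto simp: psl_eq)
    qed
    ultimately show ?thesis
      using length_ge_ln[OF c(1,2,5)] by (simp add: divide_le_eq mult.commute)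
  qed
  moreover have "\<bar>t\<bar> / sqrt 2 \<in> ?P"
  proof -
    define c where "c s = mat2 (exp (t / 2 * (1 - s))) 0 0 (exp (- (t / 2 * (1 - s))))" for s :: real
    define D where "D s = mat2 (- t / 2 * exp (t / 2 * (1 - s))) 0 0 (t / 2 * exp (- (t / 2 * (1 - s))))" for s :: real
    have c_eq: "c = (\<lambda>s. exp (t / 2 * (1 - s)) *\<^sub>R mat2 1 0 0 0 + exp (- (t / 2 * (1 - s))) *\<^sub>R mat2 0 0 0 1)"
      by (rule ext) (simp add: c_def vec_eq_iff forall_2)
    have D_eq: "D = (\<lambda>s. (- t / 2 * exp (t / 2 * (1 - s))) *\<^sub>R mat2 1 0 0 0 + (t / 2 * exp (- (t / 2 * (1 - s)))) *\<^sub>R mat2 0 0 0 1)"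
      by (rule ext) (simp add: D_def vec_eq_iff forall_2)
    have D: "(c has_vector_derivative D s) (at s)" for s
      unfolding c_eq D_eq by (auto intro!: derivative_eq_intros simp: mult.commute)
    have "continuous_on A D" for A unfolding D_eq by (intro continuous_intros) auto
    then have "valid_path c"
      unfolding valid_path_def using D
      by (intro C1_differentiable_imp_piecewise) (auto simp: C1_differentiable_on_def)
    moreover have det: "det (c s) = 1" for s by (simp add: c_def det_2 flip: exp_add)
    moreover have "c 0 \<in> ?g" "c 1 \<in> \<one>\<^bsub>PSL2\<^esub>"
      by (auto simp: c_def psl_eq one_PSL2 vec_eq_iff forall_2 mat_def)
    moreover have "norm (matrix_inv (c s) ** vector_derivative c (at s)) = \<bar>t\<bar> / sqrt 2" for s
    proof -
      have "matrix_inv (c s) ** D s = mat2 (- t / 2) 0 0 (t / 2)"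
        by (simp add: matrix_inv_mat2 det)
           (simp add: c_def D_def vec_eq_iff forall_2 matrix_matrix_mult_def sum_2 flip: exp_add)
      moreover have "sqrt ((t / 2)\<^sup>2 + (t / 2)\<^sup>2) = \<bar>t\<bar> / sqrt 2"
        by (rule real_sqrt_unique) (simp_all add: power_divide)
      ultimately show ?thesis by (simp add: vector_derivative_at[OF D] norm_mat2)
    qed
    then have "has_length c (\<bar>t\<bar> / sqrt 2)"
      using has_integral_const_real[of "\<bar>t\<bar> / sqrt 2" 0 1] by (simp add: has_length_def)
    ultimately show ?thesis
      by (auto simp: pathstart_def pathfinish_def path_image_def SL2_def)
  qed
  ultimately show ?thesis unfolding dist_G_def by (intro cInf_eq_minimum)
qed

text \<open>The value \<open>0\<close> outside \<open>T1_surface \<Gamma>\<close> is only there because \<^locale>\<open>Metric_space\<close> asks for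
  nonnegativity and symmetry on the whole type.\<close>

definition dist_T1 :: "psl2 set \<Rightarrow> (complex \<times> complex) set \<Rightarrow> (complex \<times> complex) set \<Rightarrow> real" where
  "dist_T1 \<Gamma> u v =
     (if u \<in> T1_surface \<Gamma> \<and> v \<in> T1_surface \<Gamma> then dist_X (Xi \<Gamma> u) (Xi \<Gamma> v) else 0)"


section \<open>Flows\<close>

definition continuous_flow :: "'a set \<Rightarrow> ('a \<Rightarrow> 'a \<Rightarrow> real) \<Rightarrow> (real \<Rightarrow> 'a \<Rightarrow> 'a) \<Rightarrow> bool" where
  "continuous_flow M d \<phi> \<longleftrightarrow>
     (\<forall>t. \<phi> t ` M \<subseteq> M) \<and>
     (\<forall>x\<in>M. \<phi> 0 x = x) \<and>
     (\<forall>s t. \<forall>x\<in>M. \<phi> (s + t) x = \<phi> s (\<phi> t x)) \<and>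
     continuous_map (prod_topology euclideanreal (Metric_space.mtopology M d))
                    (Metric_space.mtopology M d) (\<lambda>(t, x). \<phi> t x)"

definition KH_expansive :: "'a set \<Rightarrow> ('a \<Rightarrow> 'a \<Rightarrow> real) \<Rightarrow> (real \<Rightarrow> 'a \<Rightarrow> 'a) \<Rightarrow> bool" where
  "KH_expansive M d \<phi> \<longleftrightarrow>
     Metric_space M d \<and> compact_space (Metric_space.mtopology M d) \<and> continuous_flow M d \<phi> \<and>
     (\<exists>\<delta>>0. \<forall>x\<in>M. \<forall>y\<in>M. \<forall>s :: real \<Rightarrow> real.
        continuous_on UNIV s \<and> s 0 = 0 \<and>
        (\<forall>t. d (\<phi> t x) (\<phi> (s t) x) < \<delta>) \<and> (\<forall>t. d (\<phi> t x) (\<phi> (s t) y) < \<delta>)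
        \<longrightarrow> (\<exists>t. y = \<phi> t x))"

definition theta :: "real \<Rightarrow> psl2 set \<Rightarrow> psl2 set" where
  "theta t C = C #>\<^bsub>PSL2\<^esub> psl (mat2 1 t 0 1)"

definition horocycle_flow ::
    "psl2 set \<Rightarrow> real \<Rightarrow> (complex \<times> complex) set \<Rightarrow> (complex \<times> complex) set" where
  "horocycle_flow \<Gamma> t = Xi_inv \<circ> theta t \<circ> Xi \<Gamma>"

end

theory Submission
  imports Defs
begin

text \<open>Suppose the orbits of \<open>\<Gamma> g\<close> and \<open>\<Gamma> h\<close> stay \<open>\<delta>\<close>-close along the reparametrization \<open>s\<close>. By
  cocompactness \<open>\<Gamma>\<close> is uniformly discrete, so closeness in the quotient lifts to closeness of the
  curves \<open>g b\<^sub>t\<close> and \<open>\<gamma> h b\<^bsub>s(t)\<^esub>\<close> in \<open>PSL(2,R)\<close> for one \<open>\<gamma> \<in> \<Gamma>\<close> and all \<open>t\<close>. Applied to \<open>h = g\<close>,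
  where \<open>s(0) = 0\<close> forces \<open>\<gamma> = 1\<close>, this bounds \<open>s(t) - t\<close>. For general \<open>h\<close> the matrix
  \<open>M = g\<inverse> \<gamma> h\<close> has \<open>b\<^bsub>-t\<^esub> M b\<^bsub>s(t)\<^esub>\<close> bounded in \<open>t\<close>; its entries grow linearly in \<open>t\<close> unless \<open>M\<close> is
  \<open>b\<^sub>\<tau>\<close> up to sign, so the two points lie on the same orbit.\<close>

section \<open>Lengths of curves and the distance on PSL(2,R)\<close>

text \<open>\<open>dist_G\<close> is an infimum over curves, and what is needed about it rests on
  two estimates near the identity: a short curve from \<open>mat 1\<close> ends close to
  \<open>mat 1\<close>, and a matrix close to \<open>mat 1\<close> is reached by a short curve. The
  constants 3 and 70 in them are convenient, not sharp. PSL(2,R) is not compact, so measuring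
  nearness by the difference of matrices would give constants that depend on the place. Nearness is
  written instead as B = A E with E close to \<open>mat 1\<close>, which left invariance makes
  uniform in A.

  The condition comparing the orbit of x with its own reparametrization has a definite task. For M =
  diag(a, 1/a) the matrix b_{-t} M b_{s(t)} has upper right entry a s(t) - t/a, which vanishes when
  s(t) = t/a^2: a point displaced along the geodesic direction stays at constant distance once time
  is rescaled. The bound on s(t) - t excludes this.

  KH-expansiveness also contains the metric axioms, compactness of the space and continuity of the
  flow; these come from cocompactness and the same two estimates.\<close>

lemma valid_path_derivativeE:
  fixes c :: "real \<Rightarrow> 'a::real_normed_vector"
  assumes "valid_path c"
  obtains S where "finite S" "continuous_on {0..1} c"
    "\<And>t. t \<in> {0..1} - S \<Longrightarrow> (c has_vector_derivative vector_derivative c (at t)) (at t)"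
  using assms unfolding valid_path_def piecewise_C1_differentiable_on_def C1_differentiable_on_def
  by (metis vector_derivative_at)

text \<open>On each half the joined curve runs at twice the original speed, and the affine
  substitution absorbs the factor 2. The joined curve need not be differentiable at 1/2 or at the
  pulled-back exceptional points; these form a finite set, which the integral ignores.\<close>

lemma has_length_join:
  assumes "valid_path g1" "valid_path g2" "has_length g1 L1" "has_length g2 L2"
  shows "has_length (g1 +++ g2) (L1 + L2)"
proof -
  obtain s1 where s1: "finite s1"
    "\<And>t. t \<in> {0..1} - s1 \<Longrightarrow> (g1 has_vector_derivative vector_derivative g1 (at t)) (at t)"
    using valid_path_derivativeE[OF assms(1)] by metis
  obtain s2 where s2: "finite s2"
    "\<And>t. t \<in> {0..1} - s2 \<Longrightarrow> (g2 has_vector_derivative vector_derivative g2 (at t)) (at t)"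
    using valid_path_derivativeE[OF assms(2)] by metis
  define X where "X g t = norm (matrix_inv (g t) ** vector_derivative g (at t))" for g :: "real \<Rightarrow> mat2" and t
  have 1: "(X g1 has_integral L1) {0..1}" and 2: "(X g2 has_integral L2) {0..1}"
    using assms(3,4) unfolding has_length_def X_def by auto
  have i1: "((\<lambda>x. 2 * X g1 (2*x)) has_integral L1) {0..1/2}"
   and i2: "((\<lambda>x. 2 * X g2 (2*x - 1)) has_integral L2) {1/2..1}"
    using has_integral_affinity01 [OF 1, where m= 2 and c=0, THEN has_integral_cmul [where c=2]]
          has_integral_affinity01 [OF 2, where m= 2 and c="-1", THEN has_integral_cmul [where c=2]]
    by (simp_all only: image_affinity_atLeastAtMost_div_diff, simp_all)
  have g1: "vector_derivative (g1 +++ g2) (at z) = 2 *\<^sub>R vector_derivative g1 (at (2*z))"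
      if "0 \<le> z" "z*2 < 1" "2*z \<notin> s1" for z
  proof (rule vector_derivative_at [OF has_vector_derivative_transform_within])
    show "0 < \<bar>z - 1/2\<bar>"
      using that by auto
    have "((*) 2 has_vector_derivative 2) (at z)"
      by (simp add: has_vector_derivative_def has_derivative_def bounded_linear_mult_left)
    moreover have "(g1 has_vector_derivative vector_derivative g1 (at (2*z))) (at (2 * z))"
      using s1 that by auto
    ultimately
    show "((\<lambda>x. g1 (2 * x)) has_vector_derivative 2 *\<^sub>R vector_derivative g1 (at (2*z))) (at z)"
      by (intro vector_diff_chain_at [simplified o_def])
  qed (use that in \<open>simp_all add: dist_real_def abs_if joinpaths_def split: if_split_asm\<close>)
  have g2: "vector_derivative (g1 +++ g2) (at z) = 2 *\<^sub>R vector_derivative g2 (at (2*z - 1))"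
           if "1 < z*2" "z \<le> 1" "2*z - 1 \<notin> s2" for z
  proof (rule vector_derivative_at [OF has_vector_derivative_transform_within])
    show "0 < \<bar>z - 1/2\<bar>"
      using that by auto
    have "((\<lambda>x. 2 * x - 1) has_vector_derivative 2) (at z)"
      by (simp add: has_vector_derivative_def has_derivative_def bounded_linear_mult_left)
    moreover have "(g2 has_vector_derivative vector_derivative g2 (at (2*z - 1))) (at (2 * z - 1))"
      using s2 that by auto
    ultimately
    show "((\<lambda>x. g2 (2 * x - 1)) has_vector_derivative 2 *\<^sub>R vector_derivative g2 (at (2*z - 1))) (at z)"
      by (intro vector_diff_chain_at [simplified o_def])
  qed (use that in \<open>simp_all add: dist_real_def abs_if joinpaths_def split: if_split_asm\<close>)
  have scale: "matrix_inv M ** (2 *\<^sub>R N) = 2 *\<^sub>R (matrix_inv M ** N)" for M N :: mat2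
    by (rule linear_scale[OF bounded_linear.linear[OF bounded_linear_matrix_mult]])
  have X1: "X (g1 +++ g2) z = 2 * X g1 (2*z)" if "0 \<le> z" "z*2 < 1" "2*z \<notin> s1" for z
    using that(2) by (simp add: X_def g1[OF that] scale) (simp add: joinpaths_def)
  have X2: "X (g1 +++ g2) z = 2 * X g2 (2*z - 1)" if "1 < z*2" "z \<le> 1" "2*z - 1 \<notin> s2" for z
    using that(1) by (simp add: X_def g2[OF that] scale) (simp add: joinpaths_def)
  have "(X (g1 +++ g2) has_integral L1) {0..1/2}"
  proof (rule has_integral_spike_finite [OF _ _ i1])
    show "finite (insert (1/2) ((*) 2 -` s1))"
      using s1(1) by (force intro: finite_vimageI [where h = "(*)2"] inj_onI)
  qed (auto simp: X1)
  moreover have "(X (g1 +++ g2) has_integral L2) {1/2..1}"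
  proof (rule has_integral_spike_finite [OF _ _ i2])
    show "finite (insert (1/2) ((\<lambda>x. 2 * x - 1) -` s2))"
      using s2(1) by (force intro: finite_vimageI [where h = "\<lambda>x. 2*x-1"] inj_onI)
  qed (auto simp: X2)
  ultimately show ?thesis
    unfolding has_length_def X_def[symmetric] by (intro has_integral_combine [where c = "1/2"]) auto
qed

text \<open>Reversal changes the sign of the velocity, which the norm does not see. This gives the
  symmetry of \<open>dist_G\<close>.\<close>

lemma has_length_reversepath:
  assumes "valid_path g" "has_length g L"
  shows "has_length (reversepath g) L"
proof -
  obtain S where S: "finite S"
    "\<And>t. t \<in> {0..1} - S \<Longrightarrow> (g has_vector_derivative vector_derivative g (at t)) (at t)"
    using valid_path_derivativeE[OF assms(1)] by metis
  define X where "X g t = norm (matrix_inv (g t) ** vector_derivative g (at t))" for g :: "real \<Rightarrow> mat2" and t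
  have "((\<lambda>x. X g (1 - x)) has_integral L) {0..1}"
    using has_integral_affinity01 [where m= "-1" and c=1, OF assms(2)[unfolded has_length_def X_def[symmetric]]]
    by simp
  moreover have "vector_derivative (reversepath g) (at x) = - vector_derivative g (at (1 - x))"
    if "x \<in> {0..1} - (\<lambda>x. 1 - x) ` S" for x
  proof (rule vector_derivative_at)
    have "1 - x \<in> {0..1} - S" using that by force
    then have "(g \<circ> (\<lambda>x. 1 - x) has_vector_derivative -1 *\<^sub>R vector_derivative g (at (1 - x))) (at x)"
      by (intro vector_diff_chain_at derivative_eq_intros S(2) | simp)+
    then show "(reversepath g has_vector_derivative - vector_derivative g (at (1 - x))) (at x)"
      by (simp add: o_def reversepath_def)
  qed
  moreover have neg: "matrix_inv M ** (- N) = - (matrix_inv M ** N)" for M N :: mat2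
    by (rule linear_neg[OF bounded_linear.linear[OF bounded_linear_matrix_mult]])
  ultimately show ?thesis
    unfolding has_length_def X_def[symmetric] using S(1)
    by (rule_tac S = "(\<lambda>x. 1 - x) ` S" in has_integral_spike_finite) (auto simp: X_def reversepath_def)
qed

section \<open>Curve length near the identity and the matrix norm\<close>

lemma norm_matrix_mult_le: "norm (A ** B) \<le> norm A * norm B" for A B :: mat2
proof -
  have "(norm (A ** B))\<^sup>2 \<le> (norm A * norm B)\<^sup>2"
  proof -
    have sq: "(norm X)\<^sup>2 = (X$1$1)\<^sup>2 + (X$1$2)\<^sup>2 + (X$2$1)\<^sup>2 + (X$2$2)\<^sup>2" for X :: mat2
      unfolding norm_mat2 by (intro real_sqrt_pow2) (intro add_nonneg_nonneg zero_le_power2)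
    \<comment> \<open>Lagrange's identity, once for each pair of a row of A and a column of B: the
      defect in the Cauchy-Schwarz inequality is a square.\<close>
    have "(norm A * norm B)\<^sup>2 - (norm (A ** B))\<^sup>2 =
      (A$1$1 * B$2$1 - A$1$2 * B$1$1)\<^sup>2 + (A$1$1 * B$2$2 - A$1$2 * B$1$2)\<^sup>2 +
      (A$2$1 * B$2$1 - A$2$2 * B$1$1)\<^sup>2 + (A$2$1 * B$2$2 - A$2$2 * B$1$2)\<^sup>2"
      unfolding power_mult_distrib sq by (simp add: matrix_matrix_mult_def sum_2 power2_eq_square algebra_simps)
    also have "\<dots> \<ge> 0" by simp
    finally show ?thesis by simp
  qed
  then show ?thesis by (rule power2_le_imp_le) simp
qed

text \<open>For determinant 1 the inverse is the adjugate, which only permutes the entries and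
  changes signs.\<close>

lemma norm_matrix_inv: "det A = 1 \<Longrightarrow> norm (matrix_inv A) = norm A" for A :: mat2
  by (simp add: matrix_inv_mat2 norm_mat2)

lemma det_matrix_inv: "det A = 1 \<Longrightarrow> det (matrix_inv A) = 1" for A :: mat2
  by (simp add: matrix_inv_mat2 det_mat2 algebra_simps)

lemma abs_entry_le_norm: "\<bar>A$i$j\<bar> \<le> norm A" for A :: mat2
  using component_le_norm_cart[of "A$i" j] Finite_Cartesian_Product.norm_nth_le[of A i] by linarith

lemma norm_le_entries: "norm A \<le> \<bar>A$1$1\<bar> + \<bar>A$1$2\<bar> + \<bar>A$2$1\<bar> + \<bar>A$2$2\<bar>" for A :: mat2
proof -
  have "norm A \<le> norm (A$1) + norm (A$2)"
    using L2_set_le_sum[of UNIV "\<lambda>i. norm (A$i)"] by (simp add: norm_vec_def sum_2)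
  moreover have "norm (A$i) \<le> \<bar>A$i$1\<bar> + \<bar>A$i$2\<bar>" for i
    using norm_le_l1_cart[of "A$i"] by (simp add: sum_2)
  ultimately show ?thesis by (smt (verit))
qed

text \<open>The function \<open>ln (1 + (norm (c t - mat 1))\<^sup>2)\<close> is smooth along \<open>c\<close>, and its derivative is at
  most three times the speed of \<open>c\<close>.\<close>

lemma norm_minus_one_le_length:
  assumes c: "valid_path c" "path_image c \<subseteq> carrier SL2" "c 0 = mat 1" "has_length c L"
  shows "(norm (c 1 - mat 1))\<^sup>2 \<le> exp (3 * L) - 1"
proof -
  obtain S where S: "finite S" "continuous_on {0..1} c"
    and D: "\<And>t. t \<in> {0..1} - S \<Longrightarrow> (c has_vector_derivative vector_derivative c (at t)) (at t)"
    using valid_path_derivativeE[OF c(1)] by metis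
  have det: "det (c t) = 1" if "t \<in> {0..1}" for t
    using c(2) that by (force simp: path_image_def SL2_def)
  define f where "f t = ln (1 + (c t - mat 1) \<bullet> (c t - mat 1))" for t
  define X where "X t = norm (matrix_inv (c t) ** vector_derivative c (at t))" for t
  \<comment> \<open>The value 0 at the exceptional points is a default: the fundamental theorem
    needs the derivative only off a finite set, while the comparison of integrals needs the bound at
    every point of the interval.\<close>
  define f' where "f' t = (if t \<in> {0<..<1} - S then
    2 * ((c t - mat 1) \<bullet> vector_derivative c (at t)) / (1 + (c t - mat 1) \<bullet> (c t - mat 1)) else 0)" for t
  have pos: "1 + x \<bullet> x > 0" for x :: mat2 by (simp add: add_pos_nonneg)
  have "(f has_vector_derivative f' t) (at t)" if t: "t \<in> {0<..<1} - S" for t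
  proof -
    have "((\<lambda>t. c t - mat 1) has_vector_derivative vector_derivative c (at t)) (at t)"
      using has_vector_derivative_diff_const D[of t] t by auto
    then have "((\<lambda>t. c t - mat 1) has_derivative (\<lambda>h. h *\<^sub>R vector_derivative c (at t))) (at t)"
      by (simp add: has_vector_derivative_def)
    from has_derivative_inner[OF this this]
    have "((\<lambda>t. (c t - mat 1) \<bullet> (c t - mat 1)) has_real_derivative
        2 * ((c t - mat 1) \<bullet> vector_derivative c (at t))) (at t)"
      unfolding has_field_derivative_def by (rule has_derivative_eq_rhs) (simp add: fun_eq_iff inner_commute)
    then show ?thesis
      unfolding has_real_derivative_iff_has_vector_derivative[symmetric] f_def f'_def using t pos[of "c t - mat 1"]
      by (auto intro!: derivative_eq_intros simp: divide_simps)
  qed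
  moreover have "continuous_on {0..1} f"
    unfolding f_def using pos by (intro continuous_intros S(2)) (metis less_irrefl)
  ultimately have "(f' has_integral f 1 - f 0) {0..1}"
    by (intro fundamental_theorem_of_calculus_interior_strong[OF S(1)]) auto
  moreover have "((\<lambda>t. 3 * X t) has_integral 3 * L) {0..1}"
    using c(4) unfolding has_length_def X_def by (rule has_integral_mult_right)
  moreover have "f' t \<le> 3 * X t" if t: "t \<in> {0..1}" for t
  proof (cases "t \<in> {0<..<1} - S")
    case True
    define E where "E = c t - mat 1"
    define D where "D = vector_derivative c (at t)"
    define Y where "Y = matrix_inv (c t) ** D"
    define h where "h = norm E"
    \<comment> \<open>In terms of the logarithmic derivative Y, the velocity is D = Y + E Y, so its
      norm is at most (1 + h) times the speed.\<close>
    have "D = c t ** Y"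
      unfolding Y_def matrix_mul_assoc by (simp add: matrix_inv_mat2_inverse(1)[OF det[OF t]])
    also have "\<dots> = Y + E ** Y"
      unfolding E_def by (simp add: vec_eq_iff matrix_matrix_mult_def sum_2 forall_2 mat_def algebra_simps)
    finally have "norm D \<le> norm Y + h * norm Y"
      using norm_triangle_ineq[of Y "E ** Y"] norm_matrix_mult_le[of E Y] unfolding h_def by simp
    moreover have "E \<bullet> D \<le> h * norm D" unfolding h_def by (rule norm_cauchy_schwarz)
    moreover have h: "h \<ge> 0" by (simp add: h_def)
    ultimately have "E \<bullet> D \<le> h * (norm Y + h * norm Y)" by (meson mult_left_mono order_trans)
    \<comment> \<open>Here the factor 3 is fixed: 3 (1 + h^2) - 2 h (1 + h) = (h - 1)^2 + 2 is
      positive.\<close>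
    moreover have "3 * norm Y * (1 + h\<^sup>2) - 2 * (h * (norm Y + h * norm Y)) = norm Y * ((h - 1)\<^sup>2 + 2)"
      by (simp add: power2_eq_square algebra_simps)
    moreover have "\<dots> \<ge> 0" by simp
    ultimately have "2 * (E \<bullet> D) \<le> 3 * norm Y * (1 + h\<^sup>2)" by linarith
    then have "2 * (E \<bullet> D) / (1 + h\<^sup>2) \<le> 3 * norm Y"
      by (subst pos_divide_le_eq) (auto simp: add_pos_nonneg)
    then show ?thesis
      using True by (simp add: f'_def X_def E_def D_def Y_def h_def power2_norm_eq_inner)
  qed (auto simp: f'_def X_def)
  ultimately have "f 1 - f 0 \<le> 3 * L"
    by (rule has_integral_le)
  moreover have "f 0 = 0" by (simp add: f_def c(3))
  ultimately have "ln (1 + (norm (c 1 - mat 1))\<^sup>2) \<le> 3 * L"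
    by (simp add: f_def power2_norm_eq_inner)
  then have "1 + (norm (c 1 - mat 1))\<^sup>2 \<le> exp (3 * L)"
    using exp_le_cancel_iff[of "ln (1 + (norm (c 1 - mat 1))\<^sup>2)" "3 * L"] by (simp add: add_pos_nonneg)
  then show ?thesis by simp
qed

lemma mat2_eq_combination:
  "mat2 x y z w = x *\<^sub>R mat2 1 0 0 0 + y *\<^sub>R mat2 0 1 0 0 + z *\<^sub>R mat2 0 0 1 0 + w *\<^sub>R mat2 0 0 0 1"
  by (simp add: vec_eq_iff forall_2)

lemma continuous_on_mat2:
  assumes "continuous_on S a" "continuous_on S b" "continuous_on S c" "continuous_on S d"
  shows "continuous_on S (\<lambda>t. mat2 (a t) (b t) (c t) (d t))"
proof -
  have "continuous_on S (\<lambda>t. a t *\<^sub>R mat2 1 0 0 0 + b t *\<^sub>R mat2 0 1 0 0 + c t *\<^sub>R mat2 0 0 1 0 + d t *\<^sub>R mat2 0 0 0 1)"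
    by (intro continuous_intros assms)
  then show ?thesis by (simp only: mat2_eq_combination[symmetric])
qed

lemma has_vector_derivative_mat2:
  assumes "(a has_real_derivative a') (at s)" "(b has_real_derivative b') (at s)"
    "(c has_real_derivative c') (at s)" "(d has_real_derivative d') (at s)"
  shows "((\<lambda>t. mat2 (a t) (b t) (c t) (d t)) has_vector_derivative mat2 a' b' c' d') (at s)"
proof -
  have "((\<lambda>t. a t *\<^sub>R mat2 1 0 0 0 + b t *\<^sub>R mat2 0 1 0 0 + c t *\<^sub>R mat2 0 0 1 0 + d t *\<^sub>R mat2 0 0 0 1)
    has_vector_derivative a' *\<^sub>R mat2 1 0 0 0 + b' *\<^sub>R mat2 0 1 0 0 + c' *\<^sub>R mat2 0 0 1 0 + d' *\<^sub>R mat2 0 0 0 1) (at s)"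
    using assms by (auto intro!: derivative_eq_intros)
  then show ?thesis by (simp only: mat2_eq_combination[symmetric])
qed

text \<open>Three entries are interpolated linearly and the fourth is solved from determinant 1.
  This requires the upper left entry to stay nonzero; it is a convex combination of 1 and
  \<open>A$1$1\<close>, whence the positivity assumption. The length bound is the first-order
  estimate for A near \<open>mat 1\<close>.\<close>

lemma path_from_one:
  fixes A :: mat2
  assumes det: "det A = 1" and pos: "A$1$1 > 0"
  obtains c L where "valid_path c" "path_image c \<subseteq> carrier SL2" "c 0 = mat 1" "c 1 = A" "has_length c L"
    "norm (A - mat 1) \<le> 1/2 \<Longrightarrow> L \<le> 70 * norm (A - mat 1)"
proof -
  define x y z where xyz: "x = A$1$1 - 1" "y = A$1$2" "z = A$2$1"
  define a where "a t = 1 + t * x" for t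
  define d where "d t = (1 + t * t * (y * z)) / a t" for t
  define d' where "d' t = (2 * t * (y * z) * a t - (1 + t * t * (y * z)) * x) / (a t * a t)" for t
  define c where "c t = mat2 (a t) (t * y) (t * z) (d t)" for t
  define D where "D t = mat2 x y z (d' t)" for t
  have apos: "a t > 0" if "t \<in> {0..1}" for t
  proof -
    have "a t = (1 - t) + t * A$1$1" by (simp add: a_def xyz algebra_simps)
    moreover have "0 < (1 - t) + t * A$1$1"
      using that pos by (cases "t = 0") (auto intro!: add_nonneg_pos mult_pos_pos)
    ultimately show ?thesis by simp
  qed
  have detc: "det (c t) = 1" if "t \<in> {0..1}" for t
    using apos[OF that] by (simp add: c_def det_2 d_def)
  have ca: "continuous_on S a" for S unfolding a_def by (intro continuous_intros)
  have cd: "continuous_on {0..1} d" "continuous_on {0..1} d'"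
    unfolding d_def d'_def using apos by (auto intro!: continuous_intros ca simp: less_imp_neq[symmetric])
  have cD: "continuous_on {0..1} D"
    unfolding D_def by (intro continuous_on_mat2 cd continuous_intros)
  have D: "(c has_vector_derivative D t) (at t)" if "t \<in> {0..1}" for t
  proof -
    have a': "(a has_real_derivative x) (at t)"
      unfolding a_def by (auto intro!: derivative_eq_intros)
    have "(d has_real_derivative d' t) (at t)"
      unfolding d_def d'_def using apos[OF that]
      by (auto intro!: derivative_eq_intros a' simp: field_simps)
    then show ?thesis
      unfolding c_def D_def using a' by (intro has_vector_derivative_mat2) (auto intro!: derivative_eq_intros)
  qed
  have "valid_path c"
    unfolding valid_path_def using D cD
    by (intro C1_differentiable_imp_piecewise) (unfold C1_differentiable_on_def, blast)
  moreover have "path_image c \<subseteq> carrier SL2"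
    using detc by (auto simp: path_image_def SL2_def)
  moreover have "c 0 = mat 1"
    by (simp add: c_def a_def d_def vec_eq_iff forall_2 mat_def)
  moreover have "c 1 = A"
  proof -
    have "1 + y * z = A$1$1 * A$2$2" using det by (simp add: det_2 xyz)
    then show ?thesis using pos by (simp add: c_def a_def d_def vec_eq_iff forall_2 xyz)
  qed
  moreover define X where "X t = norm (matrix_inv (c t) ** vector_derivative c (at t))" for t
  have X: "X t = norm (matrix_inv (c t) ** D t)" if "t \<in> {0..1}" for t
    using vector_derivative_at[OF D[OF that]] by (simp add: X_def)
  have "continuous_on {0..1} X"
  proof (rule continuous_on_cong[OF refl X, THEN iffD2])
    have "matrix_inv (c t) ** D t = mat2 (d t * x - t * y * z) (d t * y - t * y * d' t)
      (a t * z - t * z * x) (a t * d' t - t * z * y)" if "t \<in> {0..1}" for t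
      by (simp add: matrix_inv_mat2[OF detc[OF that]])
        (simp add: c_def D_def vec_eq_iff forall_2 matrix_matrix_mult_def sum_2)
    moreover have "continuous_on {0..1} (\<lambda>t. norm (mat2 (d t * x - t * y * z) (d t * y - t * y * d' t)
      (a t * z - t * z * x) (a t * d' t - t * z * y)))"
      by (intro continuous_on_norm continuous_on_mat2 continuous_intros cd ca)
    ultimately show "continuous_on {0..1} (\<lambda>t. norm (matrix_inv (c t) ** D t))"
      by (subst continuous_on_cong[OF refl]) auto
  qed
  then obtain L where L: "(X has_integral L) {0..1}"
    using integrable_continuous_real by blast
  then have "has_length c L" unfolding has_length_def X_def .
  moreover have "L \<le> 70 * norm (A - mat 1)" if e: "norm (A - mat 1) \<le> 1/2"
  proof -
    define e where "e = norm (A - mat 1)"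
    have xe: "\<bar>x\<bar> \<le> e" "\<bar>y\<bar> \<le> e" "\<bar>z\<bar> \<le> e"
      using abs_entry_le_norm[of "A - mat 1" 1 1] abs_entry_le_norm[of "A - mat 1" 1 2]
        abs_entry_le_norm[of "A - mat 1" 2 1] by (simp_all add: e_def xyz mat_def)
    have e2: "e \<le> 1/2" "e \<ge> 0" using e by (simp_all add: e_def)
    have "X t \<le> 70 * e" if t: "t \<in> {0..1}" for t
    proof -
      \<comment> \<open>The entries of \<open>c t\<close> are bounded by 3/2, 1/2, 1/2 and 5/2, so
        its norm is at most 5. Those of \<open>D t\<close> are bounded by e, e, e and 11 e, so its
        norm is at most 14 e. The product gives 70 e.\<close>
      have tx: "\<bar>t * w\<bar> \<le> \<bar>w\<bar>" for w
        using t by (simp add: abs_mult mult_left_le_one_le)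
      have a: "1/2 \<le> a t" "a t \<le> 3/2"
        using tx[of x] xe e2 unfolding a_def by linarith+
      have yz: "\<bar>y * z\<bar> \<le> e / 2"
        using mult_mono[of "\<bar>y\<bar>" e "\<bar>z\<bar>" "1/2"] xe e2 by (simp add: abs_mult)
      have tyz: "\<bar>t * t * (y * z)\<bar> \<le> e / 2" "\<bar>t * (y * z)\<bar> \<le> e / 2"
        using tx[of "y * z"] tx[of "t * (y * z)"] yz by (simp_all add: mult.assoc)
      have "\<bar>d t\<bar> = \<bar>1 + t * t * (y * z)\<bar> / a t" using a by (simp add: d_def)
      also have "\<dots> \<le> (5/4) / (1/2)" using tyz e2 a by (intro frac_le) auto
      finally have dt: "\<bar>d t\<bar> \<le> 5/2" by simp
      have 1: "\<bar>2 * t * (y * z) * a t\<bar> \<le> e * (3/2)"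
        using mult_mono[of "\<bar>2 * (t * (y * z))\<bar>" e "\<bar>a t\<bar>" "3/2"] tyz a e2
        by (simp add: abs_mult mult.assoc)
      have 2: "\<bar>(1 + t * t * (y * z)) * x\<bar> \<le> (5/4) * e"
        unfolding abs_mult using tyz e2 xe by (intro mult_mono) auto
      have "\<bar>d' t\<bar> = \<bar>2 * t * (y * z) * a t - (1 + t * t * (y * z)) * x\<bar> / (a t * a t)"
        using a by (simp add: d'_def)
      also have "\<dots> \<le> (11/4 * e) / (1/2 * (1/2))"
      proof (intro frac_le mult_mono)
        show "\<bar>2 * t * (y * z) * a t - (1 + t * t * (y * z)) * x\<bar> \<le> 11/4 * e"
          using 1 2 abs_triangle_ineq4[of "2 * t * (y * z) * a t" "(1 + t * t * (y * z)) * x"] by linarith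
      qed (use a e2 in auto)
      finally have d't: "\<bar>d' t\<bar> \<le> 11 * e" by simp
      have "norm (c t) \<le> 5"
        using norm_le_entries[of "c t"] a dt tx[of y] tx[of z] xe e2 by (simp add: c_def)
      moreover have "norm (D t) \<le> 14 * e"
        using norm_le_entries[of "D t"] d't xe by (simp add: D_def)
      ultimately have "norm (c t) * norm (D t) \<le> 5 * (14 * e)"
        by (intro mult_mono) auto
      then show ?thesis
        using norm_matrix_mult_le[of "matrix_inv (c t)" "D t"] by (simp add: X[OF t] norm_matrix_inv[OF detc[OF t]])
    qed
    then have "L \<le> 70 * e"
      using has_integral_le[OF L has_integral_const_real[of "70 * e" 0 1]] by simp
    then show ?thesis by (simp add: e_def)
  qed
  ultimately show ?thesis by (rule that)
qed

section \<open>The distance as an infimum of curve lengths\<close>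

definition path_lengths :: "psl2 \<Rightarrow> psl2 \<Rightarrow> real set" where
  "path_lengths g h = {L. \<exists>c. valid_path c \<and> path_image c \<subseteq> carrier SL2 \<and>
                            pathstart c \<in> g \<and> pathfinish c \<in> h \<and> has_length c L}"

lemma dist_G_eq: "dist_G g h = Inf (path_lengths g h)"
  by (simp add: dist_G_def path_lengths_def)

lemma path_lengths_nonneg: "L \<in> path_lengths g h \<Longrightarrow> 0 \<le> L"
  unfolding path_lengths_def has_length_def by (auto intro: has_integral_nonneg)

lemma path_lengths_sym: "path_lengths g h = path_lengths h g"
proof -
  have "L \<in> path_lengths h g" if "L \<in> path_lengths g h" for g h L
  proof -
    from that obtain c where c: "valid_path c" "path_image c \<subseteq> carrier SL2"
      "pathstart c \<in> g" "pathfinish c \<in> h" "has_length c L"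
      by (auto simp: path_lengths_def)
    then show ?thesis unfolding path_lengths_def
      by (intro CollectI exI[of _ "reversepath c"]) (simp add: has_length_reversepath)
  qed
  then show ?thesis by blast
qed

lemma minus_one_mult: "- mat 1 ** A = - A" for A :: mat2
  by (rule uminus_eq_matrix_mult(1)[symmetric])

lemma matrix_mult_minus: "A ** - B = - (A ** B)" for A B :: mat2
  by (rule linear_neg[OF bounded_linear.linear[OF bounded_linear_matrix_mult]])

text \<open>A curve may be replaced by its negative, so the initial point can be prescribed.\<close>

lemma path_lengthsE:
  assumes "L \<in> path_lengths (psl A) (psl B)"
  obtains c where "valid_path c" "path_image c \<subseteq> carrier SL2"
      "c 0 = A" "c 1 \<in> psl B" "has_length c L"
proof -
  from assms obtain c where c: "valid_path c" "path_image c \<subseteq> carrier SL2"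
      "c 0 \<in> psl A" "c 1 \<in> psl B" "has_length c L"
    unfolding path_lengths_def pathstart_def pathfinish_def by blast
  show ?thesis
  proof (cases "c 0 = A")
    case True
    with c show ?thesis by (intro that)
  next
    case False
    with c(3) have "c 0 = - A" by (simp add: psl_eq)
    moreover have "path_image (\<lambda>t. - mat 1 ** c t) \<subseteq> carrier SL2"
      using c(2) by (auto simp: minus_one_mult path_image_def SL2_def)
    moreover have "- mat 1 ** c 1 \<in> psl B" using c(4) by (auto simp: minus_one_mult psl_eq)
    \<comment> \<open>In dimension 2 the matrix \<open>- mat 1\<close> has determinant 1, so
      negating a curve is a left translation and preserves its length.\<close>
    ultimately show ?thesis
      using has_length_mult[OF c(1,2) _ c(5), of "- mat 1"] by (intro that) (auto simp: minus_one_mult)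
  qed
qed

text \<open>The first curve may end at B or at - B. The second is therefore chosen to start at the
  actual endpoint of the first, so that the two can be joined in SL(2,R).\<close>

lemma path_lengths_triangle:
  assumes "L1 \<in> path_lengths (psl A) (psl B)" "L2 \<in> path_lengths (psl B) (psl C)"
  shows "L1 + L2 \<in> path_lengths (psl A) (psl C)"
proof -
  obtain c1 where c1: "valid_path c1" "path_image c1 \<subseteq> carrier SL2"
      "c1 0 = A" "c1 1 \<in> psl B" "has_length c1 L1"
    using path_lengthsE[OF assms(1)] by metis
  have "psl B = psl (c1 1)" using c1(4) by (auto simp: psl_eq)
  with assms(2) have "L2 \<in> path_lengths (psl (c1 1)) (psl C)" by simp
  then obtain c2 where c2: "valid_path c2" "path_image c2 \<subseteq> carrier SL2"
      "c2 0 = c1 1" "c2 1 \<in> psl C" "has_length c2 L2"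
    using path_lengthsE by metis
  have eq: "pathfinish c1 = pathstart c2" by (simp add: pathstart_def pathfinish_def c2)
  have "pathstart (c1 +++ c2) \<in> psl A" "pathfinish (c1 +++ c2) \<in> psl C"
    unfolding pathstart_join pathfinish_join using c1 c2 by (auto simp: pathstart_def pathfinish_def psl_eq)
  moreover have "path_image (c1 +++ c2) \<subseteq> carrier SL2"
    using c1(2) c2(2) by (intro subset_path_image_join)
  ultimately show ?thesis
    using valid_path_join[OF c1(1) c2(1) eq] has_length_join[OF c1(1) c2(1) c1(5) c2(5)]
    unfolding path_lengths_def by blast
qed

lemma path_lengths_mult:
  assumes "L \<in> path_lengths (psl A) (psl B)" "det C = 1"
  shows "L \<in> path_lengths (psl (C ** A)) (psl (C ** B))"
proof -
  obtain c where c: "valid_path c" "path_image c \<subseteq> carrier SL2"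
      "c 0 = A" "c 1 \<in> psl B" "has_length c L"
    using path_lengthsE[OF assms(1)] by metis
  have "path_image (\<lambda>t. C ** c t) \<subseteq> carrier SL2"
    using c(2) assms(2) by (auto simp: path_image_def SL2_def det_mul)
  moreover have "C ** c 1 \<in> psl (C ** B)" "C ** c 0 \<in> psl (C ** A)"
    using c(3,4) by (auto simp: psl_eq matrix_mult_minus)
  ultimately show ?thesis
    using has_length_mult[OF c(1,2) assms(2) c(5)]
    unfolding path_lengths_def pathstart_def pathfinish_def by blast
qed

lemma psl_uminus: "psl (- A) = psl A"
  by (auto simp: psl_eq)

text \<open>Connectedness of PSL(2,R). A negative upper left entry is made positive by passing to -
  A. If the entry is 0, right multiplication by a lower unipotent U makes it nonzero, and A is
  reached in two legs through A U; the second leg is the translate by A of a curve between U and the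
  identity.\<close>

lemma path_lengths_one_nonempty:
  assumes "det A = 1"
  shows "path_lengths (psl (mat 1)) (psl A) \<noteq> {}"
proof -
  have *: "path_lengths (psl (mat 1)) (psl A) \<noteq> {}" if A: "det A = 1" "A$1$1 > 0" for A
  proof -
    obtain c L where "valid_path c" "path_image c \<subseteq> carrier SL2" "c 0 = mat 1" "c 1 = A" "has_length c L"
      using path_from_one[OF A] by metis
    then have "L \<in> path_lengths (psl (mat 1)) (psl A)"
      unfolding path_lengths_def pathstart_def pathfinish_def by (auto simp: psl_eq)
    then show ?thesis by blast
  qed
  have **: "path_lengths (psl (mat 1)) (psl A) \<noteq> {}" if "det A = 1" "A$1$1 \<noteq> 0" for A
    using *[of A] *[of "- A"] that by (cases "A$1$1 > 0") (auto simp: psl_uminus)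
  show ?thesis
  proof (cases "A$1$1 = 0")
    case True
    define U where "U = mat2 1 0 1 1"
    have U: "det U = 1" "U$1$1 \<noteq> 0" by (simp_all add: U_def det_2)
    have "A$1$2 \<noteq> 0" using True assms by (auto simp: det_2)
    then have "(A ** U)$1$1 \<noteq> 0" using True by (simp add: U_def matrix_matrix_mult_def sum_2)
    moreover have "det (A ** U) = 1" using assms U by (simp add: det_mul)
    ultimately obtain L1 where L1: "L1 \<in> path_lengths (psl (mat 1)) (psl (A ** U))" using ** by blast
    obtain L2 where "L2 \<in> path_lengths (psl (mat 1)) (psl U)" using **[OF U] by blast
    from path_lengths_mult[OF this assms] have "L2 \<in> path_lengths (psl (A ** U)) (psl A)"
      by (simp add: path_lengths_sym)
    from path_lengths_triangle[OF L1 this] show ?thesis by blast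
  qed (use ** assms in blast)
qed

lemma dist_G_sym: "dist_G g h = dist_G h g"
  by (simp add: dist_G_eq path_lengths_sym)

context
  fixes g h assumes gh: "g \<in> carrier PSL2" "h \<in> carrier PSL2"
begin

lemma path_lengths_nonempty: "path_lengths g h \<noteq> {}"
proof -
  obtain A B where AB: "det A = 1" "g = psl A" "det B = 1" "h = psl B"
    using gh by (auto simp: carrier_PSL2)
  have "det (matrix_inv A ** B) = 1" by (simp add: det_mul det_matrix_inv AB)
  from path_lengths_one_nonempty[OF this] obtain L
    where "L \<in> path_lengths (psl (mat 1)) (psl (matrix_inv A ** B))" by blast
  from path_lengths_mult[OF this AB(1)] show ?thesis
    unfolding AB matrix_mul_assoc matrix_inv_mat2_inverse(1)[OF AB(1)] matrix_mul_lid matrix_mul_rid by blast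
qed

lemma dist_G_nonneg: "0 \<le> dist_G g h"
  unfolding dist_G_eq using path_lengths_nonneg by (intro cInf_greatest path_lengths_nonempty)

lemma dist_G_less_iff: "dist_G g h < r \<longleftrightarrow> (\<exists>L\<in>path_lengths g h. L < r)"
  unfolding dist_G_eq by (intro cInf_less_iff path_lengths_nonempty bdd_belowI[of _ 0] path_lengths_nonneg)

end

lemma dist_G_triangle:
  assumes "g \<in> carrier PSL2" "h \<in> carrier PSL2" "k \<in> carrier PSL2"
  shows "dist_G g k \<le> dist_G g h + dist_G h k"
proof (rule field_le_epsilon)
  fix e :: real assume "e > 0"
  then obtain L1 L2 where L: "L1 \<in> path_lengths g h" "L1 < dist_G g h + e/2"
    "L2 \<in> path_lengths h k" "L2 < dist_G h k + e/2"
    using dist_G_less_iff[of g h "dist_G g h + e/2"] dist_G_less_iff[of h k "dist_G h k + e/2"] assms by auto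
  then have "L1 + L2 \<in> path_lengths g k"
    using path_lengths_triangle assms unfolding carrier_PSL2 by blast
  \<comment> \<open>Taking r to be \<open>dist_G g k\<close> itself in
    \<open>dist_G_less_iff\<close> says that no admissible length lies below the infimum.\<close>
  then have "dist_G g k \<le> L1 + L2"
    using dist_G_less_iff[OF assms(1,3), of "L1 + L2"] dist_G_less_iff[OF assms(1,3), of "dist_G g k"]
    by (meson less_irrefl not_less)
  with L show "dist_G g k \<le> dist_G g h + dist_G h k + e" by linarith
qed

section \<open>Small distance and matrices close to the identity\<close>

lemma psl_eqD: "psl A = psl B \<Longrightarrow> det B = 1 \<Longrightarrow> det A = 1" for A B :: mat2
  by (auto simp: psl_eq doubleton_eq_iff)

text \<open>Only one of the two representatives can be expected near \<open>mat 1\<close>; B is the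
  one at which a short curve starting at \<open>mat 1\<close> ends.\<close>

lemma dist_G_one_less:
  assumes "det A = 1" "dist_G \<one>\<^bsub>PSL2\<^esub> (psl A) < r"
  obtains B where "psl B = psl A" "det B = 1" "(norm (B - mat 1))\<^sup>2 \<le> exp (3 * r) - 1"
proof -
  have "psl A \<in> carrier PSL2" "psl (mat 1) \<in> carrier PSL2" using assms by (auto simp: carrier_PSL2)
  then obtain L where L: "L \<in> path_lengths (psl (mat 1)) (psl A)" "L < r"
    using assms dist_G_less_iff by (metis one_PSL2)
  obtain c where c: "valid_path c" "path_image c \<subseteq> carrier SL2"
      "c 0 = mat 1" "c 1 \<in> psl A" "has_length c L"
    using path_lengthsE[OF L(1)] by metis
  have "psl (c 1) = psl A" using c(4) by (auto simp: psl_eq)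
  moreover have "(norm (c 1 - mat 1))\<^sup>2 \<le> exp (3 * r) - 1"
    using norm_minus_one_le_length[OF c(1,2,3,5)] L(2)
    by (smt (verit) exp_less_cancel_iff)
  ultimately show ?thesis using psl_eqD assms(1) by (metis that)
qed

lemma dist_G_one_le:
  assumes "det A = 1" "norm (A - mat 1) \<le> 1/2"
  shows "dist_G \<one>\<^bsub>PSL2\<^esub> (psl A) \<le> 70 * norm (A - mat 1)"
proof -
  have "A$1$1 > 0" using abs_entry_le_norm[of "A - mat 1" 1 1] assms(2) by (simp add: mat_def)
  then obtain c L where c: "valid_path c" "path_image c \<subseteq> carrier SL2" "c 0 = mat 1" "c 1 = A" "has_length c L"
    and L: "L \<le> 70 * norm (A - mat 1)"
    using path_from_one[OF assms(1)] assms(2) by metis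
  then have "L \<in> path_lengths \<one>\<^bsub>PSL2\<^esub> (psl A)"
    unfolding path_lengths_def pathstart_def pathfinish_def by (auto simp: psl_eq one_PSL2)
  then have "dist_G \<one>\<^bsub>PSL2\<^esub> (psl A) \<le> L"
    unfolding dist_G_eq by (intro cInf_lower bdd_belowI[of _ 0] path_lengths_nonneg)
  with L show ?thesis by simp
qed

lemma dist_G_psl:
  assumes "det A = 1" "det B = 1"
  shows "dist_G (psl A) (psl B) = dist_G \<one>\<^bsub>PSL2\<^esub> (psl (matrix_inv A ** B))"
proof -
  have "dist_G (psl A \<otimes>\<^bsub>PSL2\<^esub> psl (mat 1)) (psl A \<otimes>\<^bsub>PSL2\<^esub> psl (matrix_inv A ** B)) =
    dist_G (psl (mat 1)) (psl (matrix_inv A ** B))"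
    using assms by (intro dist_G_left_invariant) (auto simp: carrier_PSL2 det_mul det_matrix_inv)
  then show ?thesis
    using assms by (simp add: one_PSL2 psl_mult det_mul det_matrix_inv matrix_mul_assoc matrix_inv_mat2_inverse)
qed

lemma dist_G_self: "g \<in> carrier PSL2 \<Longrightarrow> dist_G g g = 0"
proof -
  assume g: "g \<in> carrier PSL2"
  obtain A where A: "g = psl A" "det A = 1" using g by (auto simp: carrier_PSL2)
  have "dist_G g g = dist_G \<one>\<^bsub>PSL2\<^esub> (psl (mat 1))"
    by (simp add: A dist_G_psl matrix_inv_mat2_inverse)
  then have "dist_G g g \<le> 0" using dist_G_one_le[of "mat 1"] by simp
  then show ?thesis using dist_G_nonneg[OF g g] by simp
qed

text \<open>The same \<epsilon> serves every A: left invariance moves A to the identity, and the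
  right factor E records the displacement.\<close>

lemma dist_G_small_imp_near:
  assumes "\<eta> > 0"
  obtains \<epsilon> where "\<epsilon> > 0"
    "\<And>A B. det A = 1 \<Longrightarrow> det B = 1 \<Longrightarrow> dist_G (psl A) (psl B) < \<epsilon> \<Longrightarrow>
       \<exists>E. psl B = psl (A ** E) \<and> det E = 1 \<and> norm (E - mat 1) < \<eta>"
proof
  \<comment> \<open>Chosen so that exp (3 \<epsilon>) - 1 is half of the square of \<eta>, which
    leaves room for the strict inequality.\<close>
  define \<epsilon> where "\<epsilon> = ln (1 + \<eta>\<^sup>2 / 2) / 3"
  show "\<epsilon> > 0" using assms by (auto intro!: ln_gt_zero simp: \<epsilon>_def)
  fix A B :: mat2 assume AB: "det A = 1" "det B = 1" "dist_G (psl A) (psl B) < \<epsilon>"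
  then have "det (matrix_inv A ** B) = 1" "dist_G \<one>\<^bsub>PSL2\<^esub> (psl (matrix_inv A ** B)) < \<epsilon>"
    by (simp_all add: dist_G_psl det_mul det_matrix_inv)
  then obtain E where E: "psl E = psl (matrix_inv A ** B)" "det E = 1" "(norm (E - mat 1))\<^sup>2 \<le> exp (3 * \<epsilon>) - 1"
    using dist_G_one_less by metis
  have "exp (3 * \<epsilon>) - 1 < \<eta>\<^sup>2" using assms by (simp add: \<epsilon>_def add_pos_nonneg)
  then have "norm (E - mat 1) < \<eta>" using E(3) assms
    by (intro power2_less_imp_less[of _ \<eta>]) auto
  moreover have "psl (A ** E) = psl B"
    using E(1,2) AB(1,2) psl_mult[of A E] psl_mult[of A "matrix_inv A ** B"]
    by (simp add: det_mul det_matrix_inv matrix_mul_assoc matrix_inv_mat2_inverse)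
  ultimately show "\<exists>E. psl B = psl (A ** E) \<and> det E = 1 \<and> norm (E - mat 1) < \<eta>"
    using E(2) by metis
qed

lemma near_imp_dist_G_small:
  assumes "\<epsilon> > 0"
  obtains \<eta> where "\<eta> > 0"
    "\<And>A E. det A = 1 \<Longrightarrow> det E = 1 \<Longrightarrow> norm (E - mat 1) < \<eta> \<Longrightarrow> dist_G (psl A) (psl (A ** E)) < \<epsilon>"
proof
  \<comment> \<open>The bound 1/2 is the range in which the length estimate holds; 140 is twice its
    constant 70.\<close>
  define \<eta> where "\<eta> = min (1/2) (\<epsilon> / 140)"
  show "\<eta> > 0" using assms by (simp add: \<eta>_def)
  fix A E :: mat2 assume AE: "det A = 1" "det E = 1" "norm (E - mat 1) < \<eta>"
  then have "dist_G (psl A) (psl (A ** E)) = dist_G \<one>\<^bsub>PSL2\<^esub> (psl E)"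
    by (simp add: dist_G_psl det_mul matrix_mul_assoc matrix_inv_mat2_inverse)
  also have "\<dots> \<le> 70 * norm (E - mat 1)" using AE by (intro dist_G_one_le) (auto simp: \<eta>_def)
  also have "\<dots> < \<epsilon>" using AE(3) assms by (simp add: \<eta>_def)
  finally show "dist_G (psl A) (psl (A ** E)) < \<epsilon>" .
qed

lemma dist_G_eq_0_imp_eq:
  assumes "g \<in> carrier PSL2" "h \<in> carrier PSL2" "dist_G g h = 0"
  shows "g = h"
proof -
  obtain A B where AB: "det A = 1" "g = psl A" "det B = 1" "h = psl B"
    using assms by (auto simp: carrier_PSL2)
  have "norm (matrix_inv A ** B - mat 1) < \<eta> \<or> norm (matrix_inv A ** B + mat 1) < \<eta>" if \<eta>: "\<eta> > 0" for \<eta>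
  proof -
    obtain \<epsilon> where "\<epsilon> > 0" and \<epsilon>: "\<And>A B. det A = 1 \<Longrightarrow> det B = 1 \<Longrightarrow> dist_G (psl A) (psl B) < \<epsilon> \<Longrightarrow>
       \<exists>E. psl B = psl (A ** E) \<and> det E = 1 \<and> norm (E - mat 1) < \<eta>"
      using dist_G_small_imp_near[OF \<eta>] by metis
    then obtain E where E: "psl B = psl (A ** E)" "det E = 1" "norm (E - mat 1) < \<eta>"
      using AB assms(3) by metis
    then have "B = A ** E \<or> B = - (A ** E)" by (auto simp: psl_eq doubleton_eq_iff)
    then have "matrix_inv A ** B = E \<or> matrix_inv A ** B = - E"
      by (auto simp: matrix_mult_minus matrix_mul_assoc matrix_inv_mat2_inverse AB)
    moreover have "norm (- E + mat 1) = norm (E - mat 1)" by (metis norm_minus_commute uminus_add_conv_diff)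
    ultimately show ?thesis using E(3) by auto
  qed
  \<comment> \<open>With \<eta> equal to the smaller of the two norms, neither can be less than
    \<eta>; so \<eta> is not positive and one of the norms vanishes.\<close>
  from this[of "min (norm (matrix_inv A ** B - mat 1)) (norm (matrix_inv A ** B + mat 1))"]
  have "matrix_inv A ** B = mat 1 \<or> matrix_inv A ** B = - mat 1"
    by (force simp: eq_neg_iff_add_eq_0)
  then have "A ** (matrix_inv A ** B) = A \<or> A ** (matrix_inv A ** B) = - A"
    by (auto simp: matrix_mult_minus)
  then have "B = A \<or> B = - A" by (simp add: matrix_mul_assoc matrix_inv_mat2_inverse AB)
  then show ?thesis using AB by (auto simp: psl_uminus)
qed

section \<open>Discrete cocompact subgroups\<close>

interpretation PSL2: group PSL2 by (rule group_PSL2)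

lemma psl_closed: "det A = 1 \<Longrightarrow> psl A \<in> carrier PSL2"
  by (auto simp: carrier_PSL2)

text \<open>Discreteness is stated in the quotient topology. Pulling an isolating open set back
  along \<open>psl\<close> turns it into a norm ball around \<open>mat 1\<close>, the form in which
  it meets the metric estimates.\<close>

lemma discrete_subgroup_isolates_one:
  assumes "discrete_subgroup \<Gamma>"
  obtains \<eta> where "\<eta> > 0"
    "\<And>A. det A = 1 \<Longrightarrow> psl A \<in> \<Gamma> \<Longrightarrow> norm (A - mat 1) < \<eta> \<Longrightarrow> psl A = \<one>\<^bsub>PSL2\<^esub>"
proof -
  have \<Gamma>: "subgroup \<Gamma> PSL2" "subtopology PSL2_topology \<Gamma> = discrete_topology \<Gamma>"
    using assms by (auto simp: discrete_subgroup_def)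
  have "openin (subtopology PSL2_topology \<Gamma>) {\<one>\<^bsub>PSL2\<^esub>}"
    using subgroup.one_closed[OF \<Gamma>(1)] by (simp add: \<Gamma>(2))
  then obtain V where V: "openin PSL2_topology V" "{\<one>\<^bsub>PSL2\<^esub>} = V \<inter> \<Gamma>"
    by (auto simp: openin_subtopology)
  have "openin (top_of_set (carrier SL2)) {A \<in> carrier SL2. psl A \<in> V}"
    using V(1) by (simp add: PSL2_topology_def openin_quotient_topology)
  moreover have "mat 1 \<in> {A \<in> carrier SL2. psl A \<in> V}"
    using V(2) by (auto simp: one_PSL2 SL2_def)
  ultimately obtain \<eta> where "\<eta> > 0"
    and \<eta>: "\<And>A. A \<in> carrier SL2 \<Longrightarrow> dist A (mat 1) < \<eta> \<Longrightarrow> A \<in> {A \<in> carrier SL2. psl A \<in> V}"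
    unfolding openin_euclidean_subtopology_iff by meson
  then show ?thesis
    using V(2) by (intro that[of \<eta>]) (auto simp: SL2_def dist_norm)
qed

lemma continuous_on_sl2_act: "det A = 1 \<Longrightarrow> continuous_on hyp_plane (sl2_act A)"
  using deriv_sl2_act by (meson DERIV_continuous continuous_at_imp_continuous_on)

text \<open>The base point component of the cocycle rule for \<open>tangent_act\<close>.\<close>

lemma psl_act_mult_ii:
  assumes "det A = 1" "det B = 1"
  shows "psl_act (psl A) (psl_act (psl B) \<i>) = psl_act (psl (A ** B)) \<i>"
proof -
  have "fst (tangent_act (psl A \<otimes>\<^bsub>PSL2\<^esub> psl B) (\<i>, \<i>)) = fst (tangent_act (psl A) (tangent_act (psl B) (\<i>, \<i>)))"
    by (simp only: tangent_act_mult[OF assms base_in_T1])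
  then show ?thesis by (simp add: tangent_act_def psl_mult assms)
qed

text \<open>The half-plane is exhausted by the sets \<open>cmod z < n + 1\<close>, \<open>Im z > 1 / (n + 1)\<close>; by
  compactness of the quotient, the translates of one of them cover it.\<close>

lemma cocompact_bounded_representatives:
  assumes "subgroup \<Gamma> PSL2" "compact_space (orbit_surface \<Gamma>)"
  obtains R where "R > 0" "\<And>g. g \<in> carrier PSL2 \<Longrightarrow>
    \<exists>\<gamma>\<in>\<Gamma>. \<exists>A. det A = 1 \<and> norm A \<le> R \<and> \<gamma> \<otimes>\<^bsub>PSL2\<^esub> g = psl A"
proof -
  define \<pi> where "\<pi> = orbit (PSL2\<lparr>carrier := \<Gamma>\<rparr>) psl_act"
  have \<pi>: "\<pi> z = (\<lambda>\<gamma>. psl_act \<gamma> z) ` \<Gamma>" for z by (auto simp: \<pi>_def orbit_def)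
  define U where "U n = {z. cmod z < real n + 1 \<and> 1 < (real n + 1) * Im z}" for n
  define V where "V n = {C \<in> \<pi> ` hyp_plane. C \<inter> U n \<noteq> {}}" for n
  have openU: "open (U n)" for n
    unfolding U_def by (intro open_Collect_conj open_Collect_less continuous_intros)
  have top: "topspace (orbit_surface \<Gamma>) = \<pi> ` hyp_plane"
    by (simp add: orbit_surface_def topspace_quotient_topology \<pi>_def)
  have "openin (orbit_surface \<Gamma>) (V n)" for n
  proof -
    \<comment> \<open>The saturation of \<open>U n\<close> is a union of preimages under elements of
      \<Gamma>, each open because Moebius maps are continuous.\<close>
    have "{z \<in> hyp_plane. \<pi> z \<in> V n} = (\<Union>\<gamma>\<in>\<Gamma>. hyp_plane \<inter> psl_act \<gamma> -` U n)"
      by (auto simp: V_def \<pi>)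
    moreover have "openin (top_of_set hyp_plane) (hyp_plane \<inter> psl_act \<gamma> -` U n)" if \<gamma>: "\<gamma> \<in> \<Gamma>" for \<gamma>
    proof -
      obtain A where "\<gamma> = psl A" "det A = 1"
        using subgroup.mem_carrier[OF assms(1) \<gamma>] by (auto simp: carrier_PSL2)
      then show ?thesis
        using continuous_on_sl2_act openU by (simp add: psl_act_psl continuous_openin_preimage_gen)
    qed
    ultimately have "openin (top_of_set hyp_plane) {z \<in> hyp_plane. \<pi> z \<in> V n}"
      by (metis (no_types, lifting) imageE openin_Union)
    then show ?thesis
      unfolding orbit_surface_def openin_quotient_topology \<pi>_def[symmetric] by (simp add: V_def subset_iff)
  qed
  moreover have "topspace (orbit_surface \<Gamma>) \<subseteq> \<Union> (range V)"
  proof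
    fix C assume "C \<in> topspace (orbit_surface \<Gamma>)"
    then obtain z where z: "C = \<pi> z" "z \<in> hyp_plane" by (auto simp: top)
    have "psl_act \<one>\<^bsub>PSL2\<^esub> z = z" by (simp add: one_PSL2 psl_act_psl sl2_act_def moebius_def mat_def)
    then have "z \<in> \<pi> z" unfolding \<pi> using subgroup.one_closed[OF assms(1)] by force
    moreover have "Im z > 0" using z by (simp add: hyp_plane_def)
    obtain n where n: "real n > max (cmod z) (1 / Im z)" using reals_Archimedean2 by blast
    then have "z \<in> U n" using \<open>Im z > 0\<close> by (simp add: U_def field_simps)
    ultimately show "C \<in> \<Union> (range V)" using z unfolding V_def by blast
  qed
  ultimately obtain F where F: "finite F" "F \<subseteq> range V" "topspace (orbit_surface \<Gamma>) \<subseteq> \<Union> F"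
    using assms(2) unfolding compact_space_alt by (metis (no_types, lifting) imageE)
  then obtain I where I: "finite I" "F = V ` I" by (meson finite_subset_image)
  obtain N where N: "\<And>n. n \<in> I \<Longrightarrow> n \<le> N" using I(1) finite_nat_set_iff_bounded_le by auto
  have U_mono: "U n \<subseteq> U m" if "n \<le> m" for n m
  proof
    fix z assume z: "z \<in> U n"
    then have "Im z > 0" using zero_less_mult_pos[of "real n + 1" "Im z"] by (simp add: U_def)
    then have "(real n + 1) * Im z \<le> (real m + 1) * Im z" using that by (intro mult_right_mono) auto
    with z that show "z \<in> U m" by (auto simp: U_def)
  qed
  define K where "K = real N + 1"
  have K: "K > 0" by (simp add: K_def)
  show ?thesis
  proof (rule that)
    show "sqrt (K + K * K\<^sup>2) > 0" using K by (simp add: add_pos_pos)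
    fix g assume "g \<in> carrier PSL2"
    then obtain B where B: "det B = 1" "g = psl B" by (auto simp: carrier_PSL2)
    have "Im (psl_act g \<i>) > 0"
      using denom_nz[OF B(1), of \<i>] by (simp add: B psl_act_psl Im_sl2_act hyp_plane_def)
    then have "\<pi> (psl_act g \<i>) \<in> topspace (orbit_surface \<Gamma>)" by (simp add: top hyp_plane_def)
    then obtain n where "n \<in> I" "\<pi> (psl_act g \<i>) \<in> V n" using F I by auto
    then have "\<pi> (psl_act g \<i>) \<inter> U N \<noteq> {}" using U_mono[OF N] by (auto simp: V_def)
    then obtain \<gamma> where \<gamma>: "\<gamma> \<in> \<Gamma>" "psl_act \<gamma> (psl_act g \<i>) \<in> U N" by (auto simp: \<pi>)
    then obtain C where C: "\<gamma> = psl C" "det C = 1"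
      using subgroup.mem_carrier[OF assms(1)] by (auto simp: carrier_PSL2)
    define A where "A = C ** B"
    have A: "det A = 1" "\<gamma> \<otimes>\<^bsub>PSL2\<^esub> g = psl A" by (simp_all add: A_def B C det_mul psl_mult)
    have "sl2_act A \<i> \<in> U N"
      using \<gamma>(2) psl_act_mult_ii[OF C(2) B(1)] by (simp add: B(2) C(1) A_def psl_act_psl)
    then have "cmod (sl2_act A \<i>) < K" "1 < K * Im (sl2_act A \<i>)" by (simp_all add: U_def K_def)
    \<comment> \<open>The rows of A can be read off the image of \<i>: its imaginary part is 1/q,
      its squared modulus is p/q, and p + q is the squared norm of A. Membership in
      \<open>U N\<close> gives q \<le> K and p \<le> q K^2, hence the radius sqrt (K + K^3).\<close>
    define p where "p = (A$1$1)\<^sup>2 + (A$1$2)\<^sup>2"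
    define q where "q = (A$2$1)\<^sup>2 + (A$2$2)\<^sup>2"
    have n: "(cmod (complex_of_real x * \<i> + complex_of_real y))\<^sup>2 = x\<^sup>2 + y\<^sup>2" for x y
      by (simp add: cmod_power2)
    have Im: "Im (sl2_act A \<i>) = 1 / q"
      using Im_sl2_act[OF A(1), of \<i>] by (simp add: n q_def hyp_plane_def)
    have q: "q > 0" unfolding q_def using A(1) by (auto simp: det_2 sum_power2_gt_zero_iff)
    have "(cmod (sl2_act A \<i>))\<^sup>2 = p / q"
      by (simp add: sl2_act_def moebius_def norm_divide power_divide n p_def q_def)
    moreover have "(cmod (sl2_act A \<i>))\<^sup>2 \<le> K\<^sup>2"
      using \<open>cmod (sl2_act A \<i>) < K\<close> by (intro power_mono) auto
    ultimately have "p \<le> q * K\<^sup>2" using q by (simp add: divide_le_eq mult.commute)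
    moreover have qK: "q \<le> K" using \<open>1 < K * Im (sl2_act A \<i>)\<close> q by (simp add: Im less_divide_eq)
    ultimately have "p + q \<le> K * K\<^sup>2 + K" 
      using mult_right_mono[OF qK, of "K\<^sup>2"] by simp
    then have "norm A \<le> sqrt (K + K * K\<^sup>2)"
      unfolding norm_mat2 p_def q_def by (intro real_sqrt_le_mono) simp
    with A \<gamma>(1) show "\<exists>\<gamma>\<in>\<Gamma>. \<exists>A. det A = 1 \<and> norm A \<le> sqrt (K + K * K\<^sup>2) \<and> \<gamma> \<otimes>\<^bsub>PSL2\<^esub> g = psl A"
      by blast
  qed
qed

text \<open>The left side is the norm of A (E - 1) times the inverse of A, and that inverse has the
  same norm as A.\<close>

lemma norm_conjugate_minus_one_le:
  fixes A E :: mat2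
  assumes "det A = 1"
  shows "norm (A ** E ** matrix_inv A - mat 1) \<le> (norm A)\<^sup>2 * norm (E - mat 1)"
proof -
  have "A ** (E - mat 1) = A ** E - A"
    using linear_diff[OF bounded_linear.linear[OF bounded_linear_matrix_mult], of A E "mat 1"] by simp
  moreover have "(X - Y) ** Z = X ** Z - Y ** Z" for X Y Z :: mat2
    by (simp add: vec_eq_iff matrix_matrix_mult_def sum_2 algebra_simps)
  ultimately have "A ** E ** matrix_inv A - mat 1 = A ** (E - mat 1) ** matrix_inv A"
    by (simp add: matrix_inv_mat2_inverse assms)
  also have "norm \<dots> \<le> norm A * norm (E - mat 1) * norm A"
    using norm_matrix_mult_le[of "A ** (E - mat 1)" "matrix_inv A"]
      mult_right_mono[OF norm_matrix_mult_le[of A "E - mat 1"], of "norm A"]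
    by (simp add: norm_matrix_inv assms)
  finally show ?thesis by (simp add: power2_eq_square mult_ac)
qed

text \<open>A positive lower bound for the displacement of points by nontrivial elements of
  \<Gamma>. Discreteness alone gives a bound near each point. Cocompactness moves g to \<tau> g =
  \<open>psl A\<close> with A of norm at most R, where the conjugate \<sigma> of \<gamma> by \<tau>
  displaces it equally little. Up to sign, \<sigma> is the conjugate by A of a matrix E near
  \<open>mat 1\<close>; conjugation costs at most a factor R^2, so \<sigma> falls into the
  neighbourhood where \<Gamma> contains only the identity.\<close>

lemma uniformly_discrete:
  assumes \<Gamma>: "discrete_subgroup \<Gamma>" "compact_space (orbit_surface \<Gamma>)"
  obtains \<epsilon> where "\<epsilon> > 0"
    "\<And>g \<gamma>. g \<in> carrier PSL2 \<Longrightarrow> \<gamma> \<in> \<Gamma> \<Longrightarrow> dist_G g (\<gamma> \<otimes>\<^bsub>PSL2\<^esub> g) < \<epsilon> \<Longrightarrow> \<gamma> = \<one>\<^bsub>PSL2\<^esub>"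
proof -
  have sub: "subgroup \<Gamma> PSL2" using \<Gamma>(1) by (simp add: discrete_subgroup_def)
  note mem = subgroup.mem_carrier[OF sub]
  obtain R where R: "R > 0" "\<And>g. g \<in> carrier PSL2 \<Longrightarrow>
    \<exists>\<gamma>\<in>\<Gamma>. \<exists>A. det A = 1 \<and> norm A \<le> R \<and> \<gamma> \<otimes>\<^bsub>PSL2\<^esub> g = psl A"
    using cocompact_bounded_representatives[OF sub \<Gamma>(2)] by metis
  obtain \<eta> where \<eta>: "\<eta> > 0"
    "\<And>A. det A = 1 \<Longrightarrow> psl A \<in> \<Gamma> \<Longrightarrow> norm (A - mat 1) < \<eta> \<Longrightarrow> psl A = \<one>\<^bsub>PSL2\<^esub>"
    using discrete_subgroup_isolates_one[OF \<Gamma>(1)] by metis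
  have "\<eta> / R\<^sup>2 > 0" using \<eta> R by simp
  then obtain \<epsilon> where \<epsilon>: "\<epsilon> > 0" "\<And>A B. det A = 1 \<Longrightarrow> det B = 1 \<Longrightarrow> dist_G (psl A) (psl B) < \<epsilon> \<Longrightarrow>
       \<exists>E. psl B = psl (A ** E) \<and> det E = 1 \<and> norm (E - mat 1) < \<eta> / R\<^sup>2"
    using dist_G_small_imp_near by metis
  show ?thesis
  proof (rule that[OF \<epsilon>(1)])
    fix g \<gamma> assume g: "g \<in> carrier PSL2" and \<gamma>: "\<gamma> \<in> \<Gamma>" and d: "dist_G g (\<gamma> \<otimes>\<^bsub>PSL2\<^esub> g) < \<epsilon>"
    obtain \<tau> A where \<tau>: "\<tau> \<in> \<Gamma>" and A: "det A = 1" "norm A \<le> R" "\<tau> \<otimes>\<^bsub>PSL2\<^esub> g = psl A"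
      using R(2)[OF g] by blast
    define \<sigma> where "\<sigma> = \<tau> \<otimes>\<^bsub>PSL2\<^esub> \<gamma> \<otimes>\<^bsub>PSL2\<^esub> inv\<^bsub>PSL2\<^esub> \<tau>"
    have \<sigma>: "\<sigma> \<in> \<Gamma>"
      unfolding \<sigma>_def using \<tau> \<gamma> by (intro subgroup.m_closed[OF sub] subgroup.m_inv_closed[OF sub])
    obtain C where C: "\<sigma> = psl C" "det C = 1" using mem[OF \<sigma>] by (auto simp: carrier_PSL2)
    have "dist_G (\<tau> \<otimes>\<^bsub>PSL2\<^esub> g) (\<tau> \<otimes>\<^bsub>PSL2\<^esub> (\<gamma> \<otimes>\<^bsub>PSL2\<^esub> g)) < \<epsilon>"
      using d g mem[OF \<gamma>] mem[OF \<tau>] by (simp add: dist_G_left_invariant)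
    moreover have "\<tau> \<otimes>\<^bsub>PSL2\<^esub> (\<gamma> \<otimes>\<^bsub>PSL2\<^esub> g) = \<sigma> \<otimes>\<^bsub>PSL2\<^esub> (\<tau> \<otimes>\<^bsub>PSL2\<^esub> g)"
      using g mem[OF \<gamma>] mem[OF \<tau>] 
      by (simp add: \<sigma>_def PSL2.m_assoc) (simp add: PSL2.m_assoc[symmetric])
    ultimately have "dist_G (psl A) (psl (C ** A)) < \<epsilon>"
      by (simp add: A(1,3) C psl_mult)
    then obtain E where E: "psl (C ** A) = psl (A ** E)" "det E = 1" "norm (E - mat 1) < \<eta> / R\<^sup>2"
      using \<epsilon>(2)[OF A(1), of "C ** A"] A C by (auto simp: det_mul)
    define D where "D = A ** E ** matrix_inv A"
    have D: "det D = 1" by (simp add: D_def det_mul det_matrix_inv A E)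
    have "psl (C ** A) \<otimes>\<^bsub>PSL2\<^esub> psl (matrix_inv A) = psl (A ** E) \<otimes>\<^bsub>PSL2\<^esub> psl (matrix_inv A)"
      by (simp only: E(1))
    then have "psl C = psl D"
      by (simp add: psl_mult det_mul det_matrix_inv A C E(2) D_def matrix_inv_mat2_inverse flip: matrix_mul_assoc)
    moreover have "norm (D - mat 1) < \<eta>"
    proof -
      have "norm (D - mat 1) \<le> (norm A)\<^sup>2 * norm (E - mat 1)"
        unfolding D_def by (rule norm_conjugate_minus_one_le[OF A(1)])
      also have "\<dots> \<le> R\<^sup>2 * norm (E - mat 1)" using A(2) by (intro mult_right_mono power_mono) auto
      also have "\<dots> < \<eta>" using E(3) R(1) by (simp add: less_divide_eq mult.commute)
      finally show ?thesis .
    qed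
    ultimately have "\<sigma> = \<one>\<^bsub>PSL2\<^esub>" using \<eta>(2)[OF D] C \<sigma> by simp
    then have "\<tau> \<otimes>\<^bsub>PSL2\<^esub> \<gamma> = \<tau>"
      using mem[OF \<gamma>] mem[OF \<tau>] unfolding \<sigma>_def by (metis PSL2.inv_solve_right PSL2.l_one PSL2.m_closed PSL2.one_closed PSL2.inv_closed)
    then show "\<gamma> = \<one>\<^bsub>PSL2\<^esub>" using mem[OF \<gamma>] mem[OF \<tau>] by (metis PSL2.l_cancel_one)
  qed
qed

section \<open>The horocycle flow\<close>

definition unipotent :: "real \<Rightarrow> psl2" where
  "unipotent t = psl (mat2 1 t 0 1)"

lemma det_unipotent: "det (mat2 1 t 0 1) = 1"
  by (simp add: det_2)

lemma unipotent_closed: "unipotent t \<in> carrier PSL2"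
  by (simp add: unipotent_def psl_closed det_unipotent)

lemma unipotent_matrix_mult: "mat2 1 s 0 1 ** mat2 1 t 0 1 = mat2 1 (s + t) 0 1"
  by (simp add: vec_eq_iff forall_2 matrix_matrix_mult_def sum_2)

lemma unipotent_add: "unipotent s \<otimes>\<^bsub>PSL2\<^esub> unipotent t = unipotent (s + t)"
  by (simp add: unipotent_def psl_mult det_unipotent unipotent_matrix_mult)

lemma unipotent_0: "unipotent 0 = \<one>\<^bsub>PSL2\<^esub>"
proof -
  have "mat2 1 0 0 1 = mat 1" by (simp add: vec_eq_iff forall_2 mat_def)
  then show ?thesis by (simp add: unipotent_def one_PSL2)
qed

text \<open>The two points differ by the right factor b_{t-s}, so left invariance gives one \<eta>
  for all g and all s.\<close>

lemma dist_G_unipotent_small: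
  assumes "\<epsilon> > 0"
  obtains \<eta> where "\<eta> > 0"
    "\<And>g s t. g \<in> carrier PSL2 \<Longrightarrow> \<bar>t - s\<bar> < \<eta> \<Longrightarrow>
       dist_G (g \<otimes>\<^bsub>PSL2\<^esub> unipotent s) (g \<otimes>\<^bsub>PSL2\<^esub> unipotent t) < \<epsilon>"
proof -
  obtain \<eta> where \<eta>: "\<eta> > 0"
    "\<And>A E. det A = 1 \<Longrightarrow> det E = 1 \<Longrightarrow> norm (E - mat 1) < \<eta> \<Longrightarrow> dist_G (psl A) (psl (A ** E)) < \<epsilon>"
    using near_imp_dist_G_small[OF assms] by metis
  show ?thesis
  proof (rule that[OF \<eta>(1)])
    fix g s t assume g: "g \<in> carrier PSL2" and st: "\<bar>t - s\<bar> < \<eta>"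
    obtain A where A: "det A = 1" "g = psl A" using g by (auto simp: carrier_PSL2)
    have "norm (mat2 1 (t - s) 0 1 - mat 1) = \<bar>t - s\<bar>"
      by (simp add: norm_mat2 mat_def)
    then have "dist_G (psl (A ** mat2 1 s 0 1)) (psl (A ** mat2 1 s 0 1 ** mat2 1 (t - s) 0 1)) < \<epsilon>"
      using st A(1) by (intro \<eta>(2)) (simp_all add: det_mul det_unipotent)
    then show "dist_G (g \<otimes>\<^bsub>PSL2\<^esub> unipotent s) (g \<otimes>\<^bsub>PSL2\<^esub> unipotent t) < \<epsilon>"
      using A by (simp add: unipotent_def psl_mult det_unipotent unipotent_matrix_mult flip: matrix_mul_assoc)
  qed
qed

text \<open>Right translations need not be isometries, but they are uniformly continuous: g E k is g
  k times the conjugate of E by the inverse of k, and the distortion is at most the squared norm of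
  that inverse.\<close>

lemma dist_G_right_mult_small:
  assumes "k \<in> carrier PSL2" "\<epsilon> > 0"
  obtains \<eta> where "\<eta> > 0"
    "\<And>g h. g \<in> carrier PSL2 \<Longrightarrow> h \<in> carrier PSL2 \<Longrightarrow> dist_G g h < \<eta> \<Longrightarrow>
       dist_G (g \<otimes>\<^bsub>PSL2\<^esub> k) (h \<otimes>\<^bsub>PSL2\<^esub> k) < \<epsilon>"
proof -
  obtain K where K: "det K = 1" "k = psl K" using assms(1) by (auto simp: carrier_PSL2)
  define B where "B = matrix_inv K"
  have B: "det B = 1" "matrix_inv B = K" "K ** B = mat 1"
    using K matrix_inv_mat2[OF det_matrix_inv[OF K(1)]]
    by (simp_all add: B_def det_matrix_inv matrix_inv_mat2_inverse)
      (simp add: matrix_inv_mat2 vec_eq_iff forall_2)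
  have pos: "norm B > 0" using B(1) by (auto simp: det_2)
  obtain \<rho> where \<rho>: "\<rho> > 0"
    "\<And>A E. det A = 1 \<Longrightarrow> det E = 1 \<Longrightarrow> norm (E - mat 1) < \<rho> \<Longrightarrow> dist_G (psl A) (psl (A ** E)) < \<epsilon>"
    using near_imp_dist_G_small[OF assms(2)] by metis
  have "\<rho> / (norm B)\<^sup>2 > 0" using pos \<rho>(1) by simp
  then obtain \<eta> where \<eta>: "\<eta> > 0"
    "\<And>A B'. det A = 1 \<Longrightarrow> det B' = 1 \<Longrightarrow> dist_G (psl A) (psl B') < \<eta> \<Longrightarrow>
       \<exists>E. psl B' = psl (A ** E) \<and> det E = 1 \<and> norm (E - mat 1) < \<rho> / (norm B)\<^sup>2"
    using dist_G_small_imp_near by metis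
  show ?thesis
  proof (rule that[OF \<eta>(1)])
    fix g h assume g: "g \<in> carrier PSL2" and h: "h \<in> carrier PSL2" and d: "dist_G g h < \<eta>"
    obtain A where A: "det A = 1" "g = psl A" using g by (auto simp: carrier_PSL2)
    obtain E where E: "h = psl (A ** E)" "det E = 1" "norm (E - mat 1) < \<rho> / (norm B)\<^sup>2"
      using \<eta>(2)[OF A(1)] h d A(2) by (auto simp: carrier_PSL2)
    have "norm (B ** E ** K - mat 1) \<le> (norm B)\<^sup>2 * norm (E - mat 1)"
      using norm_conjugate_minus_one_le[OF B(1), of E] by (simp add: B(2))
    also have "\<dots> < \<rho>" using E(3) pos by (simp add: less_divide_eq mult.commute)
    finally have "dist_G (psl (A ** K)) (psl (A ** K ** (B ** E ** K))) < \<epsilon>"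
      using A K B E(2) by (intro \<rho>(2)) (auto simp: det_mul)
    moreover have "A ** K ** (B ** E ** K) = A ** (K ** B) ** E ** K"
      by (simp only: matrix_mul_assoc)
    then have "A ** K ** (B ** E ** K) = A ** E ** K" by (simp add: B(3))
    ultimately show "dist_G (g \<otimes>\<^bsub>PSL2\<^esub> k) (h \<otimes>\<^bsub>PSL2\<^esub> k) < \<epsilon>"
      using A E(1,2) K by (simp add: psl_mult det_mul)
  qed
qed

text \<open>The upper left entry of the bounded product is affine in \<open>t\<close>, which forces \<open>M$2$1 = 0\<close>; then
  its upper right entry is affine up to a bounded error, with slope \<open>M$1$1 - M$2$2\<close>.\<close>

lemma bounded_imp_unipotent:
  fixes M :: mat2 and s :: "real \<Rightarrow> real"
  assumes "det M = 1" and s: "\<And>t. \<bar>s t - t\<bar> \<le> C"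
    and M: "\<And>t. norm (mat2 1 (- t) 0 1 ** M ** mat2 1 (s t) 0 1) \<le> C"
  obtains \<tau> where "psl M = unipotent \<tau>"
proof -
  have unbounded: "x = 0" if "\<And>t::real. \<bar>t * x\<bar> \<le> D" for x D :: real
  proof (rule ccontr)
    assume "x \<noteq> 0"
    then show False using that[of "(\<bar>D\<bar> + 1) / x"] by simp
  qed
  have entries: "(mat2 1 (- t) 0 1 ** M ** mat2 1 (s t) 0 1)$1$1 = M$1$1 - t * M$2$1"
     "(mat2 1 (- t) 0 1 ** M ** mat2 1 (s t) 0 1)$1$2 = (M$1$1 - t * M$2$1) * s t + M$1$2 - t * M$2$2" for t
    by (simp_all add: matrix_matrix_mult_def sum_2)
  have "\<bar>t * M$2$1\<bar> \<le> C + \<bar>M$1$1\<bar>" for t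
    using M[of t] abs_entry_le_norm[of "mat2 1 (- t) 0 1 ** M ** mat2 1 (s t) 0 1" 1 1]
    unfolding entries by linarith
  then have c: "M$2$1 = 0" by (rule unbounded)
  \<comment> \<open>Replacing s(t) by t costs at most C times the modulus of \<open>M$1$1\<close>;
    what remains is affine in t.\<close>
  have "\<bar>t * (M$1$1 - M$2$2)\<bar> \<le> C + \<bar>M$1$2\<bar> + \<bar>M$1$1\<bar> * C" for t
  proof -
    have "\<bar>M$1$1 * s t + M$1$2 - t * M$2$2\<bar> \<le> C"
      using M[of t] abs_entry_le_norm[of "mat2 1 (- t) 0 1 ** M ** mat2 1 (s t) 0 1" 1 2]
      unfolding entries c by simp
    moreover have "\<bar>M$1$1 * (s t - t)\<bar> \<le> \<bar>M$1$1\<bar> * C"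
      unfolding abs_mult using s by (intro mult_left_mono) auto
    moreover have "t * (M$1$1 - M$2$2) = (M$1$1 * s t + M$1$2 - t * M$2$2) - M$1$2 - M$1$1 * (s t - t)"
      by (simp add: algebra_simps)
    ultimately show ?thesis by linarith
  qed
  then have "M$1$1 - M$2$2 = 0" by (rule unbounded)
  then have d: "M$2$2 = M$1$1" by simp
  \<comment> \<open>An upper triangular matrix of determinant 1 with equal diagonal entries has
    diagonal 1 or -1, and the sign disappears in PSL(2,R).\<close>
  then have "M$1$1 * M$1$1 = 1" using assms(1) c by (simp add: det_2)
  then have "M$1$1 = 1 \<or> M$1$1 = - 1" by (simp add: square_eq_1_iff)
  then show ?thesis
  proof
    assume "M$1$1 = 1"
    then have "M = mat2 1 (M$1$2) 0 1" using c d by (simp add: vec_eq_iff forall_2)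
    then show ?thesis by (metis that unipotent_def)
  next
    assume "M$1$1 = - 1"
    then have "M = - mat2 1 (- M$1$2) 0 1" using c d by (simp add: vec_eq_iff forall_2)
    then show ?thesis by (metis that unipotent_def psl_uminus)
  qed
qed

section \<open>The unit tangent bundle as a compact metric space with a continuous flow\<close>

locale cocompact_lattice =
  fixes \<Gamma> :: "psl2 set"
  assumes discrete: "discrete_subgroup \<Gamma>"
    and cocompact: "compact_space (orbit_surface \<Gamma>)"
begin

lemma subgroup: "subgroup \<Gamma> PSL2"
  using discrete by (simp add: discrete_subgroup_def)

lemmas mem_carrier = subgroup.mem_carrier[OF subgroup]
  and one_mem = subgroup.one_closed[OF subgroup]
  and mult_mem = subgroup.m_closed[OF subgroup]
  and inv_mem = subgroup.m_inv_closed[OF subgroup]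

text \<open>Parametrizes the bundle by group elements, so that distance and flow become statements
  about representatives g.\<close>

definition point :: "psl2 \<Rightarrow> (complex \<times> complex) set" where
  "point g = Xi_inv (\<Gamma> #>\<^bsub>PSL2\<^esub> g)"

lemma T1_surface_eq: "T1_surface \<Gamma> = point ` carrier PSL2"
proof -
  have "T1_surface \<Gamma> = Xi_inv ` (rcosets\<^bsub>PSL2\<^esub> \<Gamma>)"
    using bij_betw_Xi_inv[OF subgroup] by (simp add: bij_betw_def)
  then show ?thesis by (auto simp: RCOSETS_def point_def)
qed

lemma point_in_T1_surface: "g \<in> carrier PSL2 \<Longrightarrow> point g \<in> T1_surface \<Gamma>"
  by (auto simp: T1_surface_eq)

lemma T1_surfaceE:
  assumes "x \<in> T1_surface \<Gamma>"
  obtains g where "g \<in> carrier PSL2" "x = point g"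
  using assms by (auto simp: T1_surface_eq)

lemma Xi_point: "g \<in> carrier PSL2 \<Longrightarrow> Xi \<Gamma> (point g) = \<Gamma> #>\<^bsub>PSL2\<^esub> g"
  unfolding Xi_def point_def using bij_betw_Xi_inv[OF subgroup]
  by (intro inv_into_f_f) (auto simp: bij_betw_def RCOSETS_def)

lemma point_mult:
  assumes "\<gamma> \<in> \<Gamma>" "g \<in> carrier PSL2"
  shows "point (\<gamma> \<otimes>\<^bsub>PSL2\<^esub> g) = point g"
proof -
  have "\<Gamma> #>\<^bsub>PSL2\<^esub> (\<gamma> \<otimes>\<^bsub>PSL2\<^esub> g) = (\<Gamma> #>\<^bsub>PSL2\<^esub> \<gamma>) #>\<^bsub>PSL2\<^esub> g"
    using assms mem_carrier subgroup.subset[OF subgroup] by (simp add: PSL2.coset_mult_assoc)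
  also have "\<Gamma> #>\<^bsub>PSL2\<^esub> \<gamma> = \<Gamma>"
    using assms mem_carrier subgroup by (simp add: PSL2.coset_join2)
  finally show ?thesis by (simp add: point_def)
qed

lemma horocycle_flow_point:
  assumes "g \<in> carrier PSL2"
  shows "horocycle_flow \<Gamma> t (point g) = point (g \<otimes>\<^bsub>PSL2\<^esub> unipotent t)"
  using assms subgroup.subset[OF subgroup] unipotent_closed[of t]
  by (simp add: horocycle_flow_def Xi_point theta_def PSL2.coset_mult_assoc flip: unipotent_def)
    (simp add: point_def)

lemma dist_T1_eq:
  assumes "g \<in> carrier PSL2" "h \<in> carrier PSL2"
  shows "dist_T1 \<Gamma> (point g) (point h) = (INF \<gamma>\<in>\<Gamma>. dist_G g (\<gamma> \<otimes>\<^bsub>PSL2\<^esub> h))"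
  using assms by (simp add: dist_T1_def T1_surface_eq Xi_point dist_X_rcoset[OF subgroup])

text \<open>Trades the infimum for a single group element; nonnegativity of \<open>dist_G\<close>
  supplies the lower bound that the infimum needs.\<close>

lemma dist_T1_less_iff:
  assumes "g \<in> carrier PSL2" "h \<in> carrier PSL2"
  shows "dist_T1 \<Gamma> (point g) (point h) < r \<longleftrightarrow> (\<exists>\<gamma>\<in>\<Gamma>. dist_G g (\<gamma> \<otimes>\<^bsub>PSL2\<^esub> h) < r)"
  unfolding dist_T1_eq[OF assms] using one_mem assms mem_carrier
  by (intro cINF_less_iff bdd_belowI2[of _ 0] dist_G_nonneg) auto

lemma dist_T1_nonneg:
  assumes "g \<in> carrier PSL2" "h \<in> carrier PSL2"
  shows "0 \<le> dist_T1 \<Gamma> (point g) (point h)"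
  unfolding dist_T1_eq[OF assms] using one_mem assms mem_carrier
  by (intro cINF_greatest dist_G_nonneg) auto

text \<open>Left translation by the inverse of \<gamma> turns a candidate for one infimum into a
  candidate for the other.\<close>

lemma dist_T1_sym_le:
  assumes "g \<in> carrier PSL2" "h \<in> carrier PSL2"
  shows "dist_T1 \<Gamma> (point h) (point g) \<le> dist_T1 \<Gamma> (point g) (point h)"
proof (rule field_le_epsilon)
  fix e :: real assume "e > 0"
  then obtain \<gamma> where \<gamma>: "\<gamma> \<in> \<Gamma>" "dist_G g (\<gamma> \<otimes>\<^bsub>PSL2\<^esub> h) < dist_T1 \<Gamma> (point g) (point h) + e"
    using dist_T1_less_iff[OF assms, of "dist_T1 \<Gamma> (point g) (point h) + e"] by auto
  have "dist_G h (inv\<^bsub>PSL2\<^esub> \<gamma> \<otimes>\<^bsub>PSL2\<^esub> g) = dist_G (\<gamma> \<otimes>\<^bsub>PSL2\<^esub> h) (\<gamma> \<otimes>\<^bsub>PSL2\<^esub> (inv\<^bsub>PSL2\<^esub> \<gamma> \<otimes>\<^bsub>PSL2\<^esub> g))"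
    using \<gamma> assms mem_carrier by (simp add: dist_G_left_invariant)
  also have "\<dots> = dist_G g (\<gamma> \<otimes>\<^bsub>PSL2\<^esub> h)"
    using \<gamma> assms mem_carrier by (simp add: dist_G_sym flip: PSL2.m_assoc)
  finally show "dist_T1 \<Gamma> (point h) (point g) \<le> dist_T1 \<Gamma> (point g) (point h) + e"
    using \<gamma> assms inv_mem by (intro less_imp_le) (metis dist_T1_less_iff)
qed

lemma dist_T1_triangle:
  assumes "g \<in> carrier PSL2" "h \<in> carrier PSL2" "k \<in> carrier PSL2"
  shows "dist_T1 \<Gamma> (point g) (point k) \<le> dist_T1 \<Gamma> (point g) (point h) + dist_T1 \<Gamma> (point h) (point k)"
proof (rule field_le_epsilon)
  fix e :: real assume "e > 0"
  then obtain \<gamma> \<gamma>' where \<gamma>: "\<gamma> \<in> \<Gamma>" "dist_G g (\<gamma> \<otimes>\<^bsub>PSL2\<^esub> h) < dist_T1 \<Gamma> (point g) (point h) + e/2"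
    and \<gamma>': "\<gamma>' \<in> \<Gamma>" "dist_G h (\<gamma>' \<otimes>\<^bsub>PSL2\<^esub> k) < dist_T1 \<Gamma> (point h) (point k) + e/2"
    using dist_T1_less_iff[OF assms(1,2), of "dist_T1 \<Gamma> (point g) (point h) + e/2"]
      dist_T1_less_iff[OF assms(2,3), of "dist_T1 \<Gamma> (point h) (point k) + e/2"] by auto
  note mem = mem_carrier[OF \<gamma>(1)] mem_carrier[OF \<gamma>'(1)]
  have "dist_G g (\<gamma> \<otimes>\<^bsub>PSL2\<^esub> \<gamma>' \<otimes>\<^bsub>PSL2\<^esub> k) \<le> dist_G g (\<gamma> \<otimes>\<^bsub>PSL2\<^esub> h) + dist_G (\<gamma> \<otimes>\<^bsub>PSL2\<^esub> h) (\<gamma> \<otimes>\<^bsub>PSL2\<^esub> \<gamma>' \<otimes>\<^bsub>PSL2\<^esub> k)"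
    using assms mem by (intro dist_G_triangle) auto
  also have "dist_G (\<gamma> \<otimes>\<^bsub>PSL2\<^esub> h) (\<gamma> \<otimes>\<^bsub>PSL2\<^esub> \<gamma>' \<otimes>\<^bsub>PSL2\<^esub> k) = dist_G h (\<gamma>' \<otimes>\<^bsub>PSL2\<^esub> k)"
    using assms mem by (simp add: PSL2.m_assoc dist_G_left_invariant)
  finally have "dist_G g (\<gamma> \<otimes>\<^bsub>PSL2\<^esub> \<gamma>' \<otimes>\<^bsub>PSL2\<^esub> k) < dist_T1 \<Gamma> (point g) (point h) + dist_T1 \<Gamma> (point h) (point k) + e"
    using \<gamma>(2) \<gamma>'(2) by linarith
  then show "dist_T1 \<Gamma> (point g) (point k) \<le> dist_T1 \<Gamma> (point g) (point h) + dist_T1 \<Gamma> (point h) (point k) + e"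
    using mult_mem[OF \<gamma>(1) \<gamma>'(1)] assms by (intro less_imp_le) (metis dist_T1_less_iff)
qed

text \<open>If \<gamma> h and \<gamma>' h are both close to g, they are close to each other, so
  \<gamma>' times the inverse of \<gamma> moves \<gamma> h by too little to be nontrivial. Halving
  the constant pays for the triangle inequality.\<close>

lemma separation:
  obtains \<epsilon> where "\<epsilon> > 0"
    "\<And>g h \<gamma> \<gamma>'. g \<in> carrier PSL2 \<Longrightarrow> h \<in> carrier PSL2 \<Longrightarrow> \<gamma> \<in> \<Gamma> \<Longrightarrow> \<gamma>' \<in> \<Gamma> \<Longrightarrow>
      dist_G g (\<gamma> \<otimes>\<^bsub>PSL2\<^esub> h) < \<epsilon> \<Longrightarrow> dist_G g (\<gamma>' \<otimes>\<^bsub>PSL2\<^esub> h) < \<epsilon> \<Longrightarrow> \<gamma> = \<gamma>'"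
proof -
  obtain \<epsilon> where \<epsilon>: "\<epsilon> > 0"
    "\<And>g \<gamma>. g \<in> carrier PSL2 \<Longrightarrow> \<gamma> \<in> \<Gamma> \<Longrightarrow> dist_G g (\<gamma> \<otimes>\<^bsub>PSL2\<^esub> g) < \<epsilon> \<Longrightarrow> \<gamma> = \<one>\<^bsub>PSL2\<^esub>"
    using uniformly_discrete[OF discrete cocompact] by metis
  show ?thesis
  proof (rule that)
    show "\<epsilon> / 2 > 0" using \<epsilon>(1) by simp
    fix g h \<gamma> \<gamma>' assume gh: "g \<in> carrier PSL2" "h \<in> carrier PSL2" and \<gamma>: "\<gamma> \<in> \<Gamma>" "\<gamma>' \<in> \<Gamma>"
      and d: "dist_G g (\<gamma> \<otimes>\<^bsub>PSL2\<^esub> h) < \<epsilon> / 2" "dist_G g (\<gamma>' \<otimes>\<^bsub>PSL2\<^esub> h) < \<epsilon> / 2"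
    note mem = mem_carrier[OF \<gamma>(1)] mem_carrier[OF \<gamma>(2)]
    have "dist_G (\<gamma> \<otimes>\<^bsub>PSL2\<^esub> h) (\<gamma>' \<otimes>\<^bsub>PSL2\<^esub> h) \<le> dist_G (\<gamma> \<otimes>\<^bsub>PSL2\<^esub> h) g + dist_G g (\<gamma>' \<otimes>\<^bsub>PSL2\<^esub> h)"
      using gh mem by (intro dist_G_triangle) auto
    with d have "dist_G (\<gamma> \<otimes>\<^bsub>PSL2\<^esub> h) (\<gamma>' \<otimes>\<^bsub>PSL2\<^esub> h) < \<epsilon>"
      by (simp add: dist_G_sym[of "\<gamma> \<otimes>\<^bsub>PSL2\<^esub> h" g])
    moreover have "\<gamma>' \<otimes>\<^bsub>PSL2\<^esub> h = (\<gamma>' \<otimes>\<^bsub>PSL2\<^esub> inv\<^bsub>PSL2\<^esub> \<gamma>) \<otimes>\<^bsub>PSL2\<^esub> (\<gamma> \<otimes>\<^bsub>PSL2\<^esub> h)"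
      using gh mem by (simp add: PSL2.m_assoc) (simp flip: PSL2.m_assoc)
    ultimately have "\<gamma>' \<otimes>\<^bsub>PSL2\<^esub> inv\<^bsub>PSL2\<^esub> \<gamma> = \<one>\<^bsub>PSL2\<^esub>"
      using gh mem \<gamma> by (intro \<epsilon>(2)[of "\<gamma> \<otimes>\<^bsub>PSL2\<^esub> h"] mult_mem inv_mem) auto
    then show "\<gamma> = \<gamma>'" using mem by (metis PSL2.inv_closed PSL2.inv_equality PSL2.inv_inv)
  qed
qed

text \<open>An infimum equal to 0 could fail to be attained. Separation forces the same \<gamma> to
  serve at every small scale, so this \<gamma> attains it.\<close>

lemma dist_T1_eq_0_imp_eq:
  assumes "g \<in> carrier PSL2" "h \<in> carrier PSL2" "dist_T1 \<Gamma> (point g) (point h) = 0"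
  shows "point g = point h"
proof -
  obtain \<epsilon> where \<epsilon>: "\<epsilon> > 0"
    "\<And>g h \<gamma> \<gamma>'. g \<in> carrier PSL2 \<Longrightarrow> h \<in> carrier PSL2 \<Longrightarrow> \<gamma> \<in> \<Gamma> \<Longrightarrow> \<gamma>' \<in> \<Gamma> \<Longrightarrow>
      dist_G g (\<gamma> \<otimes>\<^bsub>PSL2\<^esub> h) < \<epsilon> \<Longrightarrow> dist_G g (\<gamma>' \<otimes>\<^bsub>PSL2\<^esub> h) < \<epsilon> \<Longrightarrow> \<gamma> = \<gamma>'"
    using separation by metis
  obtain \<gamma> where \<gamma>: "\<gamma> \<in> \<Gamma>" "dist_G g (\<gamma> \<otimes>\<^bsub>PSL2\<^esub> h) < \<epsilon>"
    using dist_T1_less_iff[OF assms(1,2), of \<epsilon>] \<epsilon>(1) assms(3) by auto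
  have "dist_G g (\<gamma> \<otimes>\<^bsub>PSL2\<^esub> h) < r" if "r > 0" for r
  proof -
    obtain \<gamma>' where \<gamma>': "\<gamma>' \<in> \<Gamma>" "dist_G g (\<gamma>' \<otimes>\<^bsub>PSL2\<^esub> h) < min r \<epsilon>"
      using dist_T1_less_iff[OF assms(1,2), of "min r \<epsilon>"] \<epsilon>(1) \<open>r > 0\<close> assms(3) by auto
    with \<epsilon>(2)[OF assms(1,2) \<gamma>(1) \<gamma>'(1) \<gamma>(2)] show ?thesis by simp
  qed
  from this[of "dist_G g (\<gamma> \<otimes>\<^bsub>PSL2\<^esub> h)"] have "dist_G g (\<gamma> \<otimes>\<^bsub>PSL2\<^esub> h) = 0"
    using dist_G_nonneg[of g "\<gamma> \<otimes>\<^bsub>PSL2\<^esub> h"] assms mem_carrier[OF \<gamma>(1)] by force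
  then have "g = \<gamma> \<otimes>\<^bsub>PSL2\<^esub> h"
    using assms mem_carrier[OF \<gamma>(1)] by (intro dist_G_eq_0_imp_eq) auto
  then show ?thesis using point_mult \<gamma>(1) assms(2) by simp
qed

lemma Metric_space_T1: "Metric_space (T1_surface \<Gamma>) (dist_T1 \<Gamma>)"
proof
  show "0 \<le> dist_T1 \<Gamma> x y" for x y
  proof (cases "x \<in> T1_surface \<Gamma> \<and> y \<in> T1_surface \<Gamma>")
    case True
    then show ?thesis using dist_T1_nonneg by (auto simp: T1_surface_eq)
  qed (auto simp: dist_T1_def)
  show "dist_T1 \<Gamma> x y = dist_T1 \<Gamma> y x" for x y
  proof (cases "x \<in> T1_surface \<Gamma> \<and> y \<in> T1_surface \<Gamma>")
    case True
    then show ?thesis using dist_T1_sym_le by (auto simp: T1_surface_eq intro: antisym)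
  qed (auto simp: dist_T1_def)
next
  fix x y assume "x \<in> T1_surface \<Gamma>" "y \<in> T1_surface \<Gamma>"
  then obtain g h where gh: "x = point g" "y = point h" "g \<in> carrier PSL2" "h \<in> carrier PSL2"
    by (auto simp: T1_surface_eq)
  have "dist_T1 \<Gamma> (point g) (point g) < r" if "r > 0" for r
    using dist_T1_less_iff[OF gh(3,3), of r] one_mem dist_G_self[OF gh(3)] gh(3) that by force
  from this[of "dist_T1 \<Gamma> (point g) (point g)"] have "dist_T1 \<Gamma> (point g) (point g) = 0"
    using dist_T1_nonneg[OF gh(3,3)] by force
  then show "(dist_T1 \<Gamma> x y = 0) = (x = y)"
    using dist_T1_eq_0_imp_eq gh by auto
next
  show "dist_T1 \<Gamma> x z \<le> dist_T1 \<Gamma> x y + dist_T1 \<Gamma> y z"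
    if "x \<in> T1_surface \<Gamma>" "y \<in> T1_surface \<Gamma>" "z \<in> T1_surface \<Gamma>" for x y z
    using that dist_T1_triangle by (auto simp: T1_surface_eq)
qed

sublocale T1: Metric_space "T1_surface \<Gamma>" "dist_T1 \<Gamma>"
  by (rule Metric_space_T1)

lemma dist_T1_le_dist_G:
  assumes "g \<in> carrier PSL2" "h \<in> carrier PSL2" "dist_G g h < r"
  shows "dist_T1 \<Gamma> (point g) (point h) < r"
  using dist_T1_less_iff[OF assms(1,2)] assms one_mem by force

text \<open>The bundle is the continuous image of the matrices of determinant 1 and norm at most R,
  a closed and bounded set.\<close>

lemma compact_T1: "compact_space T1.mtopology"
proof -
  obtain R where R: "R > 0" "\<And>g. g \<in> carrier PSL2 \<Longrightarrow>
    \<exists>\<gamma>\<in>\<Gamma>. \<exists>A. det A = 1 \<and> norm A \<le> R \<and> \<gamma> \<otimes>\<^bsub>PSL2\<^esub> g = psl A"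
    using cocompact_bounded_representatives[OF subgroup cocompact] by metis
  define K where "K = {A :: mat2. det A = 1} \<inter> cball 0 R"
  have "closed {A :: mat2. det A = 1}"
    unfolding det_2 by (intro closed_Collect_eq continuous_intros)
  then have "compact K" unfolding K_def by (intro closed_Int_compact compact_cball)
  moreover have "continuous_map (top_of_set K) T1.mtopology (\<lambda>A. point (psl A))"
    unfolding T1.continuous_map_to_metric
  proof (intro ballI allI impI)
    fix A and e :: real assume A: "A \<in> topspace (top_of_set K)" and "e > 0"
    then have detA: "det A = 1" by (simp add: K_def)
    obtain \<eta> where \<eta>: "\<eta> > 0"
      "\<And>A E. det A = 1 \<Longrightarrow> det E = 1 \<Longrightarrow> norm (E - mat 1) < \<eta> \<Longrightarrow> dist_G (psl A) (psl (A ** E)) < e"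
      using near_imp_dist_G_small[OF \<open>e > 0\<close>] by metis
    have posA: "norm A > 0" using detA by (auto simp: det_2)
    \<comment> \<open>The radius is divided by the norm of A because the relevant displacement is
      \<open>matrix_inv A ** (B - A)\<close>, and the inverse of A has the norm of A.\<close>
    define U where "U = K \<inter> ball A (\<eta> / norm A)"
    have "openin (top_of_set K) U" by (simp add: U_def openin_open_Int)
    moreover have "A \<in> U" using A \<eta>(1) posA by (simp add: U_def)
    moreover have "point (psl B) \<in> T1.mball (point (psl A)) e" if "B \<in> U" for B
    proof -
      have B: "det B = 1" "norm (B - A) < \<eta> / norm A"
        using that by (auto simp: U_def K_def dist_norm norm_minus_commute)
      have "matrix_inv A ** (B - A) = matrix_inv A ** B - mat 1"
        using linear_diff[OF bounded_linear.linear[OF bounded_linear_matrix_mult], of "matrix_inv A" B A]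
        by (simp add: matrix_inv_mat2_inverse detA)
      then have "norm (matrix_inv A ** B - mat 1) \<le> norm A * norm (B - A)"
        using norm_matrix_mult_le[of "matrix_inv A" "B - A"] by (simp add: norm_matrix_inv detA)
      also have "\<dots> < \<eta>" using B(2) posA by (simp add: less_divide_eq mult.commute)
      finally have "dist_G (psl A) (psl (A ** (matrix_inv A ** B))) < e"
        by (intro \<eta>(2)) (simp_all add: detA B det_mul det_matrix_inv)
      then have "dist_G (psl A) (psl B) < e"
        by (simp add: matrix_mul_assoc matrix_inv_mat2_inverse detA)
      then show ?thesis
        using dist_T1_le_dist_G psl_closed[OF detA] psl_closed[OF B(1)] by (simp add: point_in_T1_surface)
    qed
    ultimately show "\<exists>U. openin (top_of_set K) U \<and> A \<in> U \<and>
        (\<forall>B\<in>U. point (psl B) \<in> T1.mball (point (psl A)) e)" by blast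
  qed
  ultimately have "compactin T1.mtopology ((\<lambda>A. point (psl A)) ` K)"
    by (intro image_compactin[where X = "top_of_set K"]) (simp_all add: compactin_subtopology)
  moreover have "(\<lambda>A. point (psl A)) ` K = T1_surface \<Gamma>"
  proof (intro subset_antisym subsetI)
    fix x assume "x \<in> T1_surface \<Gamma>"
    then obtain g where g: "x = point g" "g \<in> carrier PSL2" by (auto simp: T1_surface_eq)
    then obtain \<gamma> A where "\<gamma> \<in> \<Gamma>" "det A = 1" "norm A \<le> R" "\<gamma> \<otimes>\<^bsub>PSL2\<^esub> g = psl A"
      using R(2) by blast
    then show "x \<in> (\<lambda>A. point (psl A)) ` K"
      using g point_mult[of \<gamma> g] by (intro image_eqI[of _ _ A]) (simp_all add: K_def)
  qed (auto simp: T1_surface_eq K_def psl_closed)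
  ultimately show ?thesis by (simp add: compact_space_def)
qed

lemma continuous_flow_horocycle: "continuous_flow (T1_surface \<Gamma>) (dist_T1 \<Gamma>) (horocycle_flow \<Gamma>)"
  unfolding continuous_flow_def
proof (intro conjI allI ballI)
  show "horocycle_flow \<Gamma> t ` T1_surface \<Gamma> \<subseteq> T1_surface \<Gamma>" for t
    by (auto simp: T1_surface_eq horocycle_flow_point unipotent_closed)
  show "horocycle_flow \<Gamma> 0 x = x" if "x \<in> T1_surface \<Gamma>" for x
    using that by (auto simp: T1_surface_eq horocycle_flow_point unipotent_0)
  show "horocycle_flow \<Gamma> (s + t) x = horocycle_flow \<Gamma> s (horocycle_flow \<Gamma> t x)" if "x \<in> T1_surface \<Gamma>" for s t x
    using that by (auto simp: T1_surface_eq horocycle_flow_point unipotent_closed PSL2.m_assoc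
        unipotent_add add.commute)
  show "continuous_map (prod_topology euclideanreal T1.mtopology) T1.mtopology (\<lambda>(t, x). horocycle_flow \<Gamma> t x)"
    unfolding T1.continuous_map_to_metric
  proof (intro ballI allI impI)
    fix p and e :: real assume "p \<in> topspace (prod_topology euclideanreal T1.mtopology)" and e: "e > 0"
    then obtain t g where p: "p = (t, point g)" and g: "g \<in> carrier PSL2" by (auto elim: T1_surfaceE)
    \<comment> \<open>The error is split: the base point moves at the fixed time t, with \<eta>1
      depending on t; then time moves at the new base point, where the uniformity of \<eta>2 in the
      base point is essential.\<close>
    have e2: "e / 2 > 0" using e by simp
    obtain \<eta>1 where \<eta>1: "\<eta>1 > 0" "\<And>g h. g \<in> carrier PSL2 \<Longrightarrow> h \<in> carrier PSL2 \<Longrightarrow> dist_G g h < \<eta>1 \<Longrightarrow>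
       dist_G (g \<otimes>\<^bsub>PSL2\<^esub> unipotent t) (h \<otimes>\<^bsub>PSL2\<^esub> unipotent t) < e / 2"
      using dist_G_right_mult_small[OF unipotent_closed e2] by metis
    obtain \<eta>2 where \<eta>2: "\<eta>2 > 0" "\<And>g s t. g \<in> carrier PSL2 \<Longrightarrow> \<bar>t - s\<bar> < \<eta>2 \<Longrightarrow>
       dist_G (g \<otimes>\<^bsub>PSL2\<^esub> unipotent s) (g \<otimes>\<^bsub>PSL2\<^esub> unipotent t) < e / 2"
      using dist_G_unipotent_small[OF e2] by metis
    define U where "U = ball t \<eta>2 \<times> T1.mball (point g) \<eta>1"
    have "openin (prod_topology euclideanreal T1.mtopology) U"
      by (simp add: U_def openin_prod_Times_iff)
    moreover have "p \<in> U" using \<eta>1(1) \<eta>2(1) g by (simp add: U_def p point_in_T1_surface)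
    moreover have "(case q of (t, x) \<Rightarrow> horocycle_flow \<Gamma> t x) \<in>
        T1.mball (case p of (t, x) \<Rightarrow> horocycle_flow \<Gamma> t x) e" if qU: "q \<in> U" for q
    proof -
      obtain s h where q: "q = (s, point h)" "h \<in> carrier PSL2" "\<bar>s - t\<bar> < \<eta>2"
          "dist_T1 \<Gamma> (point g) (point h) < \<eta>1"
        using qU by (auto simp: U_def dist_real_def abs_minus_commute) (metis T1_surfaceE)
      then obtain \<gamma> where \<gamma>: "\<gamma> \<in> \<Gamma>" "dist_G g (\<gamma> \<otimes>\<^bsub>PSL2\<^esub> h) < \<eta>1"
        using dist_T1_less_iff g by auto
      have k: "\<gamma> \<otimes>\<^bsub>PSL2\<^esub> h \<in> carrier PSL2" using \<gamma> q(2) mem_carrier by simp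
      have "dist_G (g \<otimes>\<^bsub>PSL2\<^esub> unipotent t) (\<gamma> \<otimes>\<^bsub>PSL2\<^esub> h \<otimes>\<^bsub>PSL2\<^esub> unipotent s) < e"
        using dist_G_triangle[of "g \<otimes>\<^bsub>PSL2\<^esub> unipotent t" "\<gamma> \<otimes>\<^bsub>PSL2\<^esub> h \<otimes>\<^bsub>PSL2\<^esub> unipotent t"
            "\<gamma> \<otimes>\<^bsub>PSL2\<^esub> h \<otimes>\<^bsub>PSL2\<^esub> unipotent s"] \<eta>1(2)[OF g k \<gamma>(2)] \<eta>2(2)[OF k q(3)] g k unipotent_closed
        by simp
      then have "dist_T1 \<Gamma> (point (g \<otimes>\<^bsub>PSL2\<^esub> unipotent t)) (point (h \<otimes>\<^bsub>PSL2\<^esub> unipotent s)) < e"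
        using dist_T1_less_iff[of "g \<otimes>\<^bsub>PSL2\<^esub> unipotent t" "h \<otimes>\<^bsub>PSL2\<^esub> unipotent s" e] g q(2) \<gamma>(1) mem_carrier
          unipotent_closed by (auto simp: PSL2.m_assoc)
      then show ?thesis
        using g q(2) unipotent_closed by (simp add: p q(1) horocycle_flow_point point_in_T1_surface)
    qed
    ultimately show "\<exists>U. openin (prod_topology euclideanreal T1.mtopology) U \<and> p \<in> U \<and>
        (\<forall>q\<in>U. (case q of (t, x) \<Rightarrow> horocycle_flow \<Gamma> t x) \<in>
          T1.mball (case p of (t, x) \<Rightarrow> horocycle_flow \<Gamma> t x) e)" by blast
  qed
qed

text \<open>The element of \<open>\<Gamma>\<close> realizing closeness at time \<open>t\<close> is unique by uniform discreteness, hence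
  locally constant in \<open>t\<close>, hence constant.\<close>

lemma shadowing_lifts:
  obtains \<epsilon> where "\<epsilon> > 0"
    "\<And>\<delta> g h s. \<delta> \<le> \<epsilon> \<Longrightarrow> g \<in> carrier PSL2 \<Longrightarrow> h \<in> carrier PSL2 \<Longrightarrow> continuous_on UNIV s \<Longrightarrow>
      (\<And>t. dist_T1 \<Gamma> (horocycle_flow \<Gamma> t (point g)) (horocycle_flow \<Gamma> (s t) (point h)) < \<delta>) \<Longrightarrow>
      \<exists>\<gamma>\<in>\<Gamma>. \<forall>t. dist_G (g \<otimes>\<^bsub>PSL2\<^esub> unipotent t) (\<gamma> \<otimes>\<^bsub>PSL2\<^esub> h \<otimes>\<^bsub>PSL2\<^esub> unipotent (s t)) < \<delta>"
proof -
  obtain \<epsilon> where \<epsilon>: "\<epsilon> > 0"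
    "\<And>g h \<gamma> \<gamma>'. g \<in> carrier PSL2 \<Longrightarrow> h \<in> carrier PSL2 \<Longrightarrow> \<gamma> \<in> \<Gamma> \<Longrightarrow> \<gamma>' \<in> \<Gamma> \<Longrightarrow>
      dist_G g (\<gamma> \<otimes>\<^bsub>PSL2\<^esub> h) < \<epsilon> \<Longrightarrow> dist_G g (\<gamma>' \<otimes>\<^bsub>PSL2\<^esub> h) < \<epsilon> \<Longrightarrow> \<gamma> = \<gamma>'"
    using separation by metis
  show ?thesis
  proof (rule that[OF \<epsilon>(1)])
    fix \<delta> g h and s :: "real \<Rightarrow> real"
    assume \<delta>: "\<delta> \<le> \<epsilon>" and g: "g \<in> carrier PSL2" and h: "h \<in> carrier PSL2" and s: "continuous_on UNIV s"
      and close: "\<And>t. dist_T1 \<Gamma> (horocycle_flow \<Gamma> t (point g)) (horocycle_flow \<Gamma> (s t) (point h)) < \<delta>"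
    define D where "D \<gamma> t = dist_G (g \<otimes>\<^bsub>PSL2\<^esub> unipotent t) (\<gamma> \<otimes>\<^bsub>PSL2\<^esub> h \<otimes>\<^bsub>PSL2\<^esub> unipotent (s t))" for \<gamma> t
    have D_eq: "D \<gamma> t = dist_G (g \<otimes>\<^bsub>PSL2\<^esub> unipotent t) (\<gamma> \<otimes>\<^bsub>PSL2\<^esub> (h \<otimes>\<^bsub>PSL2\<^esub> unipotent (s t)))" if "\<gamma> \<in> \<Gamma>" for \<gamma> t
      using mem_carrier[OF that] h unipotent_closed by (simp add: D_def PSL2.m_assoc)
    have ex: "\<exists>\<gamma>\<in>\<Gamma>. D \<gamma> t < \<delta>" for t
      using close[of t] D_eq g h unipotent_closed
      by (simp add: horocycle_flow_point dist_T1_less_iff)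
    define f where "f t = (SOME \<gamma>. \<gamma> \<in> \<Gamma> \<and> D \<gamma> t < \<delta>)" for t
    have f: "f t \<in> \<Gamma>" "D (f t) t < \<delta>" for t
      using someI_ex[of "\<lambda>\<gamma>. \<gamma> \<in> \<Gamma> \<and> D \<gamma> t < \<delta>"] ex unfolding f_def by blast+
    have unique: "\<gamma> = \<gamma>'" if "\<gamma> \<in> \<Gamma>" "\<gamma>' \<in> \<Gamma>" "D \<gamma> t < \<delta>" "D \<gamma>' t < \<delta>" for \<gamma> \<gamma>' t
      using \<epsilon>(2)[of "g \<otimes>\<^bsub>PSL2\<^esub> unipotent t" "h \<otimes>\<^bsub>PSL2\<^esub> unipotent (s t)" \<gamma> \<gamma>'] that \<delta> g h unipotent_closed
      by (simp add: D_eq)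
    have "\<forall>\<^sub>F u in at t. f t = f u" for t
    proof -
      \<comment> \<open>Half of the slack at time t: in passing from t to u each of the two
        endpoints moves by less than e.\<close>
      define e where "e = (\<delta> - D (f t) t) / 2"
      have "e > 0" using f(2)[of t] by (simp add: e_def)
      then obtain \<eta> where \<eta>: "\<eta> > 0" "\<And>g s t. g \<in> carrier PSL2 \<Longrightarrow> \<bar>t - s\<bar> < \<eta> \<Longrightarrow>
         dist_G (g \<otimes>\<^bsub>PSL2\<^esub> unipotent s) (g \<otimes>\<^bsub>PSL2\<^esub> unipotent t) < e"
        using dist_G_unipotent_small by metis
      have "(s \<longlongrightarrow> s t) (at t)" using s by (simp add: continuous_on_def)
      then have "\<forall>\<^sub>F u in at t. dist (s u) (s t) < \<eta>" using \<eta>(1) by (rule tendstoD)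
      moreover have "\<forall>\<^sub>F u in at t. dist u t < \<eta>" using \<eta>(1) by (intro tendstoD[OF tendsto_ident_at])
      ultimately show ?thesis
      proof eventually_elim
        case (elim u)
        have k: "f t \<otimes>\<^bsub>PSL2\<^esub> h \<in> carrier PSL2" using h mem_carrier[OF f(1)] by simp
        have "dist_G (g \<otimes>\<^bsub>PSL2\<^esub> unipotent u) (g \<otimes>\<^bsub>PSL2\<^esub> unipotent t) < e"
          using elim by (intro \<eta>(2) g) (simp add: dist_real_def abs_minus_commute)
        moreover have "dist_G (f t \<otimes>\<^bsub>PSL2\<^esub> h \<otimes>\<^bsub>PSL2\<^esub> unipotent (s t)) (f t \<otimes>\<^bsub>PSL2\<^esub> h \<otimes>\<^bsub>PSL2\<^esub> unipotent (s u)) < e"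
          using elim by (intro \<eta>(2) k) (simp add: dist_real_def)
        ultimately have "D (f t) u < D (f t) t + 2 * e"
          using dist_G_triangle[of "g \<otimes>\<^bsub>PSL2\<^esub> unipotent u" "g \<otimes>\<^bsub>PSL2\<^esub> unipotent t"
              "f t \<otimes>\<^bsub>PSL2\<^esub> h \<otimes>\<^bsub>PSL2\<^esub> unipotent (s u)"]
            dist_G_triangle[of "g \<otimes>\<^bsub>PSL2\<^esub> unipotent t" "f t \<otimes>\<^bsub>PSL2\<^esub> h \<otimes>\<^bsub>PSL2\<^esub> unipotent (s t)"
              "f t \<otimes>\<^bsub>PSL2\<^esub> h \<otimes>\<^bsub>PSL2\<^esub> unipotent (s u)"] g k unipotent_closed
          by (simp add: D_def)
        also have "D (f t) t + 2 * e = \<delta>" by (simp add: e_def field_simps)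
        finally have "D (f t) u < \<delta>" .
        then show ?case using unique f by blast
      qed
    qed
    then have "f t = f 0" for t
      using connected_local_const[of UNIV t 0 f] by simp
    then have "D (f 0) t < \<delta>" for t using f(2)[of t] by metis
    then show "\<exists>\<gamma>\<in>\<Gamma>. \<forall>t. dist_G (g \<otimes>\<^bsub>PSL2\<^esub> unipotent t) (\<gamma> \<otimes>\<^bsub>PSL2\<^esub> h \<otimes>\<^bsub>PSL2\<^esub> unipotent (s t)) < \<delta>"
      using f(1) unfolding D_def by blast
  qed
qed

text \<open>Three scales enter \<delta>: \<epsilon>1 lifts shadowing to PSL(2,R), \<epsilon>2
  identifies the lifting element for the pair (x, x) at time 0, and \<epsilon>3 turns closeness in
  PSL(2,R) into a bound on matrices.\<close>

lemma horocycle_separation: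
  obtains \<delta> where "\<delta> > 0"
    "\<And>x y s. x \<in> T1_surface \<Gamma> \<Longrightarrow> y \<in> T1_surface \<Gamma> \<Longrightarrow> continuous_on UNIV s \<Longrightarrow> s 0 = 0 \<Longrightarrow>
      (\<And>t. dist_T1 \<Gamma> (horocycle_flow \<Gamma> t x) (horocycle_flow \<Gamma> (s t) x) < \<delta>) \<Longrightarrow>
      (\<And>t. dist_T1 \<Gamma> (horocycle_flow \<Gamma> t x) (horocycle_flow \<Gamma> (s t) y) < \<delta>) \<Longrightarrow>
      \<exists>t. y = horocycle_flow \<Gamma> t x"
proof -
  obtain \<epsilon>1 where \<epsilon>1: "\<epsilon>1 > 0" "\<And>\<delta> g h s. \<delta> \<le> \<epsilon>1 \<Longrightarrow> g \<in> carrier PSL2 \<Longrightarrow> h \<in> carrier PSL2 \<Longrightarrow> continuous_on UNIV s \<Longrightarrow>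
      (\<And>t. dist_T1 \<Gamma> (horocycle_flow \<Gamma> t (point g)) (horocycle_flow \<Gamma> (s t) (point h)) < \<delta>) \<Longrightarrow>
      \<exists>\<gamma>\<in>\<Gamma>. \<forall>t. dist_G (g \<otimes>\<^bsub>PSL2\<^esub> unipotent t) (\<gamma> \<otimes>\<^bsub>PSL2\<^esub> h \<otimes>\<^bsub>PSL2\<^esub> unipotent (s t)) < \<delta>"
    using shadowing_lifts by metis
  obtain \<epsilon>2 where \<epsilon>2: "\<epsilon>2 > 0" "\<And>g \<gamma>. g \<in> carrier PSL2 \<Longrightarrow> \<gamma> \<in> \<Gamma> \<Longrightarrow> dist_G g (\<gamma> \<otimes>\<^bsub>PSL2\<^esub> g) < \<epsilon>2 \<Longrightarrow> \<gamma> = \<one>\<^bsub>PSL2\<^esub>"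
    using uniformly_discrete[OF discrete cocompact] by metis
  obtain \<epsilon>3 where \<epsilon>3: "\<epsilon>3 > 0" "\<And>A B. det A = 1 \<Longrightarrow> det B = 1 \<Longrightarrow> dist_G (psl A) (psl B) < \<epsilon>3 \<Longrightarrow>
       \<exists>E. psl B = psl (A ** E) \<and> det E = 1 \<and> norm (E - mat 1) < 1"
    using dist_G_small_imp_near[of 1] by (metis zero_less_one)
  \<comment> \<open>The bound 3 is 2 + 1: \<open>mat 1\<close> has norm at most 2 and E differs from
    it by less than 1. The unknown sign does not affect the norm.\<close>
  have bounded: "norm (matrix_inv A ** B) \<le> 3"
    if AB: "det A = 1" "det B = 1" "dist_G (psl A) (psl B) < \<epsilon>3" for A B
  proof -
    obtain E where E: "psl B = psl (A ** E)" "norm (E - mat 1) < 1" using \<epsilon>3(2)[OF AB] by blast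
    have "B = A ** E \<or> B = - (A ** E)" using E(1) by (auto simp: psl_eq doubleton_eq_iff)
    then have "matrix_inv A ** B = E \<or> matrix_inv A ** B = - E"
      using AB(1) by (auto simp: matrix_mult_minus matrix_mul_assoc matrix_inv_mat2_inverse)
    then have "norm (matrix_inv A ** B) = norm E" by auto
    moreover have "norm (mat 1 :: mat2) \<le> 2"
      using norm_le_entries[of "mat 1"] by (simp add: mat_def)
    ultimately show ?thesis using E(2) norm_triangle_sub[of E "mat 1"] by linarith
  qed
  define \<delta> where "\<delta> = Min {\<epsilon>1, \<epsilon>2, \<epsilon>3}"
  have \<delta>: "\<delta> > 0" "\<delta> \<le> \<epsilon>1" "\<delta> \<le> \<epsilon>2" "\<delta> \<le> \<epsilon>3"
    using \<epsilon>1(1) \<epsilon>2(1) \<epsilon>3(1) by (simp_all add: \<delta>_def)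
  show ?thesis
  proof (rule that[OF \<delta>(1)])
    fix x y and s :: "real \<Rightarrow> real"
    assume "x \<in> T1_surface \<Gamma>" "y \<in> T1_surface \<Gamma>" and s: "continuous_on UNIV s" "s 0 = 0"
      and xx: "\<And>t. dist_T1 \<Gamma> (horocycle_flow \<Gamma> t x) (horocycle_flow \<Gamma> (s t) x) < \<delta>"
      and xy: "\<And>t. dist_T1 \<Gamma> (horocycle_flow \<Gamma> t x) (horocycle_flow \<Gamma> (s t) y) < \<delta>"
    then obtain g h where x: "x = point g" and y: "y = point h" and g: "g \<in> carrier PSL2" and h: "h \<in> carrier PSL2"
      by (auto simp: T1_surface_eq)
    have bnd: "norm (mat2 1 (- t) 0 1 ** (matrix_inv A ** B) ** mat2 1 (s t) 0 1) \<le> 3"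
      if AB: "det A = 1" "det B = 1" "dist_G (psl A \<otimes>\<^bsub>PSL2\<^esub> unipotent t) (psl B \<otimes>\<^bsub>PSL2\<^esub> unipotent (s t)) < \<delta>" for A B t
    proof -
      \<comment> \<open>The matrix from A b_t to B b_{s(t)} is thereby b_{-t} times the matrix from
        A to B times b_{s(t)}.\<close>
      have "matrix_inv (A ** mat2 1 t 0 1) = mat2 1 (- t) 0 1 ** matrix_inv A"
        using AB(1) by (simp add: matrix_inv_mat2 det_mul det_unipotent)
          (simp add: vec_eq_iff forall_2 matrix_matrix_mult_def sum_2)
      then show ?thesis
        using bounded[of "A ** mat2 1 t 0 1" "B ** mat2 1 (s t) 0 1"] AB \<delta>(4)
        by (simp add: det_mul det_unipotent unipotent_def psl_mult matrix_mul_assoc)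
    qed
    obtain A where A: "g = psl A" "det A = 1" using g by (auto simp: carrier_PSL2)
    have "\<bar>s t - t\<bar> \<le> 3" for t
    proof -
      obtain \<gamma> where \<gamma>: "\<gamma> \<in> \<Gamma>"
        "\<And>t. dist_G (g \<otimes>\<^bsub>PSL2\<^esub> unipotent t) (\<gamma> \<otimes>\<^bsub>PSL2\<^esub> g \<otimes>\<^bsub>PSL2\<^esub> unipotent (s t)) < \<delta>"
        using \<epsilon>1(2)[OF \<delta>(2) g g s(1)] xx by (auto simp: x)
      have "dist_G g (\<gamma> \<otimes>\<^bsub>PSL2\<^esub> g) < \<epsilon>2"
        using \<gamma>(2)[of 0] \<delta>(3) g mem_carrier[OF \<gamma>(1)] by (simp add: s(2) unipotent_0)
      then have "\<gamma> = \<one>\<^bsub>PSL2\<^esub>" using \<epsilon>2(2) g \<gamma>(1) by blast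
      \<comment> \<open>With trivial \<gamma> both curves start from A, so the matrix between them
        is b_{s(t)-t}, whose upper right entry is the drift of the reparametrization.\<close>
      then have "norm (mat2 1 (s t - t) 0 1) \<le> 3"
        using \<gamma>(2)[of t] bnd[OF A(2,2), of t] g A
        by (simp add: matrix_inv_mat2_inverse unipotent_matrix_mult)
      then show ?thesis using abs_entry_le_norm[of "mat2 1 (s t - t) 0 1" 1 2] by simp
    qed
    moreover obtain \<gamma> where \<gamma>: "\<gamma> \<in> \<Gamma>"
        "\<And>t. dist_G (g \<otimes>\<^bsub>PSL2\<^esub> unipotent t) (\<gamma> \<otimes>\<^bsub>PSL2\<^esub> h \<otimes>\<^bsub>PSL2\<^esub> unipotent (s t)) < \<delta>"
      using \<epsilon>1(2)[OF \<delta>(2) g h s(1)] xy by (auto simp: x y)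
    obtain B where B: "\<gamma> \<otimes>\<^bsub>PSL2\<^esub> h = psl B" "det B = 1"
      using PSL2.m_closed[OF mem_carrier[OF \<gamma>(1)] h] unfolding carrier_PSL2 by blast
    have M: "det (matrix_inv A ** B) = 1" by (simp add: det_mul det_matrix_inv A B)
    have "norm (mat2 1 (- t) 0 1 ** (matrix_inv A ** B) ** mat2 1 (s t) 0 1) \<le> 3" for t
      using \<gamma>(2)[of t] by (intro bnd) (simp_all add: A B)
    ultimately obtain \<tau> where "psl (matrix_inv A ** B) = unipotent \<tau>"
      using bounded_imp_unipotent[OF M] by metis
    then have "psl B = g \<otimes>\<^bsub>PSL2\<^esub> unipotent \<tau>"
      using A M by (simp add: psl_mult matrix_mul_assoc matrix_inv_mat2_inverse flip: \<open>psl (matrix_inv A ** B) = unipotent \<tau>\<close>)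
    \<comment> \<open>Here B represents \<gamma> h, which gives the same point as h in the
      quotient.\<close>
    then have "point h = point (g \<otimes>\<^bsub>PSL2\<^esub> unipotent \<tau>)"
      using point_mult[OF \<gamma>(1) h] B(1) by simp
    then show "\<exists>t. y = horocycle_flow \<Gamma> t x"
      using horocycle_flow_point[OF g] x y by metis
  qed
qed

end

theorem theorem3p12:
  fixes \<Gamma> :: "psl2 set"
  assumes "discrete_subgroup \<Gamma>"
    and "acts_freely \<Gamma>"
    and "compact_space (orbit_surface \<Gamma>)"
  shows "KH_expansive (T1_surface \<Gamma>) (dist_T1 \<Gamma>) (horocycle_flow \<Gamma>)"
proof -
  interpret cocompact_lattice \<Gamma> using assms(1,3) by unfold_locales
  obtain \<delta> where \<delta>: "\<delta> > 0"
    "\<And>x y s. x \<in> T1_surface \<Gamma> \<Longrightarrow> y \<in> T1_surface \<Gamma> \<Longrightarrow> continuous_on UNIV s \<Longrightarrow> s 0 = 0 \<Longrightarrow>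
      (\<And>t. dist_T1 \<Gamma> (horocycle_flow \<Gamma> t x) (horocycle_flow \<Gamma> (s t) x) < \<delta>) \<Longrightarrow>
      (\<And>t. dist_T1 \<Gamma> (horocycle_flow \<Gamma> t x) (horocycle_flow \<Gamma> (s t) y) < \<delta>) \<Longrightarrow>
      \<exists>t. y = horocycle_flow \<Gamma> t x"
    using horocycle_separation by metis
  show ?thesis
    unfolding KH_expansive_def
    using Metric_space_T1 compact_T1 continuous_flow_horocycle \<delta> by blast
qed

end
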